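(* Let $p$ be a prime number, let $r$ be a positive integer, and let $\Delta \subset \mathbb{R}^d$ be a $d$-dimensional lattice simplex with normalized volume $p^2$. Suppose that $\Delta$ is not a lattice pyramid over any lower-dimensional lattice simplex. Then $\Delta$ is Gorenstein of index $r$ if and only if one of the following is satisfied: (1) There exists an integer $s$ with $0 \le s \le d-1$ such that $rp^2 - 1 = (d-s) + ps$ and, for some ordering of the vertices of $\Delta$, $\Lambda_\Delta$ is generated by $$\Big(\underbrace{\tfrac{1}{p},\ldots,\tfrac{1}{p}}_{s},\underbrace{\tfrac{1}{p^2},\ldots,\tfrac{1}{p^2}}_{d-s+1}\Big).$$ (2) $d = rp-1$ and there exist an integer $s$ with $1 \le s \le d-1$ and integers $1 \le a_1,\ldots,a_{s-1} \le p-1$ such that, for some ordering of the vertices of $\Delta$, $\Lambda_\Delta$ is generated by the two elements $$\Big(\tfrac{2 - \sum_{1\le i\le s-1} a_i}{p}, \tfrac{a_1+1}{p},\ldots,\tfrac{a_{s-1}+1}{p}, 0, \underbrace{\tfrac1p,\ldots,\tfrac1p}_{d-s}\Big)$$ and $$\Big(\tfrac{(\sum_{1\le i\le s-1} a_i) - 1}{p}, \tfrac{p-a_1}{p},\ldots,\tfrac{p-a_{s-1}}{p}, \tfrac1p, \underbrace{0,\ldots,0}_{d-s}\Big)$$ of $(\mathbb{R}/\mathbb{Z})^{d+1}$.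
   Context: A lattice polytope is a convex polytope all of whose vertices have integer coordinates. The normalized volume $\mathrm{Vol}(\mathcal{P})$ of a $d$-dimensional lattice polytope $\mathcal{P}\subset\mathbb{R}^d$ is $d!$ times its Euclidean volume. For a $d$-dimensional lattice simplex $\Delta \subset \mathbb{R}^d$ with (ordered) vertices $v_0,\ldots,v_d \in \mathbb{Z}^d$, define the finite abelian group $$\Lambda_\Delta = \{(\lambda_0,\ldots,\lambda_d) \in (\mathbb{R}/\mathbb{Z})^{d+1} : \textstyle\sum_{i=0}^d \lambda_i (v_i,1) \in \mathbb{Z}^{d+1}\}$$ with componentwise addition (its order is $\mathrm{Vol}(\Delta)$). Two $d$-dimensional lattice polytopes in $\mathbb{R}^d$ are unimodularly equivalent if one is obtained from the other by $v \mapsto vU + w$ with $U \in \mathbb{Z}^{d\times d}$, $\det U = \pm 1$, $w \in \mathbb{Z}^d$. The lattice pyramid over $\mathcal{P}\subset\mathbb{R}^{d-1}$ is $\mathrm{Pyr}(\mathcal{P}) = \mathrm{conv}(\mathcal{P}\times\{0\}, (0,\ldots,0,1)) \subset \mathbb{R}^{d}$; $\Delta$ is called a lattice pyramid over a lower-dimensional lattice simplex if it is unimodularly equivalent to $\mathrm{Pyr}(\Delta')$ for some lattice simplex $\Delta'$ of dimension $d-1$. A $d$-dimensional lattice polytope $\mathcal{Q} \subset \mathbb{R}^d$ is reflexive if the origin is the unique lattice point in its interior and its dual polytope $\mathcal{Q}^\vee = \{y \in \mathbb{R}^d : \langle x,y\rangle \le 1 \text{ for all } x \in \mathcal{Q}\}$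 is also a lattice polytope. A $d$-dimensional lattice polytope $\mathcal{P} \subset \mathbb{R}^d$ is Gorenstein of index $r$ ($r \in \mathbb{Z}_{>0}$) if there exist a reflexive polytope $\mathcal{Q} \subset \mathbb{R}^d$ and $w \in \mathbb{Z}^d$ with $\mathcal{Q} = r\mathcal{P} + w$. *)

theory Defs
  imports "HOL-Analysis.Analysis" "HOL-Algebra.Product_Groups"
begin

definition int_lattice :: "(real^'n) set" where
  "int_lattice = {x. \<forall>i. x $ i \<in> \<int>}"

definition vertices :: "(real^'n) set \<Rightarrow> (real^'n) set" where
  "vertices P = {x. x extreme_point_of P}"

definition lattice_polytope :: "(real^'n) set \<Rightarrow> bool" where
  "lattice_polytope P \<longleftrightarrow> polytope P \<and> vertices P \<subseteq> int_lattice"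

definition full_dimensional :: "(real^'n) set \<Rightarrow> bool" where
  "full_dimensional P \<longleftrightarrow> aff_dim P = int CARD('n)"

definition lattice_simplex :: "nat \<Rightarrow> (real^'n) set \<Rightarrow> bool" where
  "lattice_simplex k S \<longleftrightarrow> lattice_polytope S \<and> int k simplex S"

definition normalized_volume :: "(real^'n) set \<Rightarrow> real" where
  "normalized_volume P = fact CARD('n) * measure lebesgue P"

definition unimodularly_equivalent :: "(real^'n) set \<Rightarrow> (real^'n) set \<Rightarrow> bool" where
  "unimodularly_equivalent P Q \<longleftrightarrow>
     (\<exists>(U :: real^'n^'n) w. (\<forall>i j. U $ i $ j \<in> \<int>) \<and> (det U = 1 \<or> det U = - 1) \<and>
        w \<in> int_lattice \<and> Q = (\<lambda>v. v v* U + w) ` P)"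

text \<open>
  The dimension \<open>d = CARD('n)\<close> is a type, so \<open>\<real>\<^bsup>d-1\<^esup> \<times> {0}\<close> is rendered as a coordinate hyperplane
  \<open>x $ k = 0\<close> of \<open>\<real>\<^sup>d\<close>, and a polytope in \<open>\<real>\<^bsup>d-1\<^esup>\<close> as a subset of it. The index type has no
  distinguished last element; all choices of \<open>k\<close> give the same notion of lattice pyramid, since
  permuting coordinates is unimodular.
\<close>

definition pyramid :: "'n \<Rightarrow> (real^'n) set \<Rightarrow> (real^'n) set" where
  "pyramid k P = convex hull (P \<union> {axis k 1})"

definition is_lattice_pyramid :: "(real^'n) set \<Rightarrow> bool" where
  "is_lattice_pyramid S \<longleftrightarrow>
     (\<exists>k S'. S' \<subseteq> {x. x $ k = 0} \<and> lattice_simplex (CARD('n) - 1) S' \<and>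
        unimodularly_equivalent S (pyramid k S'))"

definition dual_polytope :: "(real^'n) set \<Rightarrow> (real^'n) set" where
  "dual_polytope Q = {y. \<forall>x\<in>Q. x \<bullet> y \<le> 1}"

definition reflexive :: "(real^'n) set \<Rightarrow> bool" where
  "reflexive Q \<longleftrightarrow> lattice_polytope Q \<and> full_dimensional Q \<and>
     interior Q \<inter> int_lattice = {0} \<and> lattice_polytope (dual_polytope Q)"

definition gorenstein :: "nat \<Rightarrow> (real^'n) set \<Rightarrow> bool" where
  "gorenstein r P \<longleftrightarrow> 0 < r \<and> lattice_polytope P \<and> full_dimensional P \<and>
     (\<exists>Q w. reflexive Q \<and> w \<in> int_lattice \<and> Q = (\<lambda>x. real r *\<^sub>R x + w) ` P)"

definition real_add_group :: "real monoid" where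
  "real_add_group = \<lparr>carrier = UNIV, mult = (+), one = 0\<rparr>"

definition RZ :: "real set monoid" where
  "RZ = real_add_group Mod \<int>"

definition torus :: "nat \<Rightarrow> (nat \<Rightarrow> real set) monoid" where
  "torus d = product_group {0..d} (\<lambda>_. RZ)"

definition torus_class :: "nat \<Rightarrow> (nat \<Rightarrow> real) \<Rightarrow> nat \<Rightarrow> real set" where
  "torus_class d x = (\<lambda>i\<in>{0..d}. \<int> #>\<^bsub>real_add_group\<^esub> x i)"

definition vertex_ordering :: "(nat \<Rightarrow> real^'n) \<Rightarrow> (real^'n) set \<Rightarrow> bool" where
  "vertex_ordering v S \<longleftrightarrow> bij_betw v {0..CARD('n)} (vertices S)"

text \<open>
  \<open>Lambda v\<close> depends on the ordering \<open>v\<close> of the vertices. For integral vertices the defining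
  condition does not depend on the chosen representatives \<open>x\<close>.
\<close>

definition Lambda :: "(nat \<Rightarrow> real^'n) \<Rightarrow> (nat \<Rightarrow> real set) set" where
  "Lambda v = {torus_class CARD('n) x | x.
     (\<Sum>i = 0..CARD('n). x i *\<^sub>R (v i, 1 :: real)) \<in> int_lattice \<times> \<int>}"

end

theory Submission
  imports Defs
begin

text \<open>
  Let \<open>V\<close> be the vertex set of \<open>\<Delta>\<close>, lift each vertex \<open>u\<close> to \<open>(u, 1)\<close>, and let \<open>coord u\<close> be the
  linear coordinate functionals of the resulting basis of \<open>\<real>\<^sup>d \<times> \<real>\<close>. The group of \<open>\<Delta>\<close> consists
  of the coordinate vectors of the integer points, taken modulo \<open>1\<close>. For every vertex \<open>u\<close> the
  values of \<open>coord u\<close> on integer points form a cyclic group \<open>(1 / m u) \<int>\<close>, so that \<open>m u\<close> times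
  \<open>coord u\<close> is the primitive inner normal of the facet opposite to \<open>u\<close>. Three facts reduce the
  theorem to a statement about the group alone.

  \<^item> \<open>\<Delta>\<close> is Gorenstein of index \<open>r\<close> iff some integer point at height \<open>r\<close> has coordinates
    \<open>1 / m u\<close>, that is, lies at lattice distance \<open>1\<close> from every facet of the cone over \<open>\<Delta>\<close>
    (\<open>gorenstein_iff\<close>). The vertices of the dual of \<open>r\<Delta> + w\<close> are explicit multiples of the facet
    normals (\<open>dual_dilate\<close>), and asking them to be integral is precisely this condition.

  \<^item> The group has order \<open>p\<^sup>2\<close>, since its order is the normalized volume
    (\<open>normalized_volume_eq_card\<close>). This compares two fundamental domains of the lattice spanned by
    the edge vectors at a vertex.

  \<^item> If \<open>m u = 1\<close>, then \<open>\<Delta>\<close> is a lattice pyramid with apex \<open>u\<close> (\<open>pyramid_if_coord_integral\<close>):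
    a unimodular map turns the facet normal into a coordinate functional and the apex into a unit
    vector.

  Hence every \<open>m u\<close> is \<open>p\<close> or \<open>p\<^sup>2\<close>, and \<open>e = (1 / m u)\<close> is an element of the group. If some
  \<open>m u = p\<^sup>2\<close>, then \<open>e\<close> has order \<open>p\<^sup>2\<close> and generates the group; the sum of its coordinates being
  \<open>r\<close> is the numerical condition of the first case (\<open>cyclic_case\<close>). If all \<open>m u = p\<close>, then the
  group is generated by \<open>e = (1/p, \<dots>, 1/p)\<close> and any element outside of its span. Subtracting a
  multiple of \<open>e\<close> creates a zero coordinate, rescaling modulo \<open>p\<close> creates a coordinate \<open>1/p\<close>, and
  integrality of the sum forces at least one further nonzero coordinate and determines that
  coordinate from the others; this is the second generator of the second case, and the first
  generator is its difference from \<open>e\<close> (\<open>elementary_case\<close>). Conversely, in both cases \<open>e\<close> can be read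
  off from the generators.
\<close>

section \<open>Integer points and barycentric coordinates\<close>

lemma int_lattice_add: "x \<in> int_lattice \<Longrightarrow> y \<in> int_lattice \<Longrightarrow> x + y \<in> int_lattice"
  by (simp add: int_lattice_def)

lemma int_lattice_diff: "x \<in> int_lattice \<Longrightarrow> y \<in> int_lattice \<Longrightarrow> x - y \<in> int_lattice"
  by (simp add: int_lattice_def)

lemma int_lattice_uminus: "x \<in> int_lattice \<Longrightarrow> - x \<in> int_lattice"
  by (simp add: int_lattice_def)

lemma int_lattice_scaleR: "k \<in> \<int> \<Longrightarrow> x \<in> int_lattice \<Longrightarrow> k *\<^sub>R x \<in> int_lattice"
  by (simp add: int_lattice_def)

lemma int_lattice_zero: "0 \<in> int_lattice"
  by (simp add: int_lattice_def)

lemma int_lattice_sum: "(\<And>i. i \<in> A \<Longrightarrow> f i \<in> int_lattice) \<Longrightarrow> sum f A \<in> int_lattice"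
  by (auto simp: int_lattice_def intro!: Ints_sum)

lemma int_lattice_axis: "axis k 1 \<in> int_lattice"
  by (simp add: int_lattice_def axis_def)

lemma inner_int_lattice: "x \<in> int_lattice \<Longrightarrow> y \<in> int_lattice \<Longrightarrow> x \<bullet> y \<in> \<int>"
  by (auto simp: inner_vec_def int_lattice_def intro!: Ints_sum Ints_mult)

locale lattice_simplex_vertices =
  fixes V :: "(real^'n) set"
  assumes indep: "\<not> affine_dependent V"
    and cardV: "card V = CARD('n) + 1"
    and latV: "V \<subseteq> int_lattice"
begin

lemma finV: "finite V"
  using indep by (rule aff_independent_finite)

text \<open>
  An affine relation among the vertices is the same thing as a linear relation among their lifts to
  height \<open>1\<close>: the last component says that the coefficients sum to zero.
\<close>

lemma homogenized_independent: "independent ((\<lambda>u. (u, 1 :: real)) ` V)"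
proof
  assume "dependent ((\<lambda>u. (u, 1 :: real)) ` V)"
  then obtain c where c: "\<exists>z\<in>(\<lambda>u. (u, 1 :: real)) ` V. c z \<noteq> 0"
    "(\<Sum>z\<in>(\<lambda>u. (u, 1 :: real)) ` V. c z *\<^sub>R z) = 0"
    using finV by (subst (asm) real_vector.dependent_finite) auto
  have inj: "inj_on (\<lambda>u. (u, 1 :: real)) V"
    by (auto intro: inj_onI)
  have "(\<Sum>u\<in>V. c (u, 1) *\<^sub>R (u, 1 :: real)) = 0"
    using c(2) by (simp add: sum.reindex[OF inj] del: scaleR_Pair)
  then have "(\<Sum>u\<in>V. c (u, 1)) = 0" "(\<Sum>u\<in>V. c (u, 1) *\<^sub>R u) = 0"
    by (auto simp: sum_prod prod_eq_iff fst_sum snd_sum)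
  then have "affine_dependent V"
    using c(1) unfolding affine_dependent_explicit_finite[OF finV]
    by (intro exI[of _ "\<lambda>u. c (u, 1)"]) auto
  with indep show False ..
qed

text \<open>
  On points \<open>(x, 1)\<close> this is the barycentric coordinate of \<open>x\<close> at the vertex \<open>u\<close>; on points
  \<open>(x, 0)\<close> it is the linear part of that affine function.
\<close>

definition coord :: "real^'n \<Rightarrow> (real^'n) \<times> real \<Rightarrow> real" where
  "coord u = (SOME f. linear f \<and> (\<forall>w\<in>V. f (w, 1) = (if w = u then 1 else 0)))"

lemma coord_spec: "linear (coord u) \<and> (\<forall>w\<in>V. coord u (w, 1) = (if w = u then 1 else 0))"
proof -
  obtain g where "linear g"
    "\<forall>z\<in>(\<lambda>u. (u, 1 :: real)) ` V. g z = (if fst z = u then 1 else 0 :: real)"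
    using linear_independent_extend[OF homogenized_independent,
        of "\<lambda>z. if fst z = u then 1 else 0 :: real"] by blast
  then have "linear g \<and> (\<forall>w\<in>V. g (w, 1) = (if w = u then 1 else 0))"
    by auto
  then show ?thesis
    unfolding coord_def
    by (rule someI[of "\<lambda>f. linear f \<and> (\<forall>w\<in>V. f (w, 1) = (if w = u then 1 else 0))"])
qed

lemma linear_coord: "linear (coord u)"
  using coord_spec by blast

lemma coord_vertex: "w \<in> V \<Longrightarrow> coord u (w, 1) = (if w = u then 1 else 0)"
  using coord_spec by blast

lemmas coord_simps = linear_add[OF linear_coord] linear_diff[OF linear_coord]
  linear_scale[OF linear_coord] linear_sum[OF linear_coord] linear_0[OF linear_coord]

lemma coord_add: "coord u (x + y, s + t) = coord u (x, s) + coord u (y, t)"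
  using linear_add[OF linear_coord, of u "(x, s)" "(y, t)"] by simp

lemma coord_diff: "coord u (x - y, s - t) = coord u (x, s) - coord u (y, t)"
  using linear_diff[OF linear_coord, of u "(x, s)" "(y, t)"] by simp

lemma coord_scale: "coord u (c *\<^sub>R x, c * t) = c * coord u (x, t)"
  using linear_scale[OF linear_coord, of u c "(x, t)"] by simp

lemma span_homogenized: "span ((\<lambda>u. (u, 1 :: real)) ` V) = UNIV"
proof -
  have "card ((\<lambda>u. (u, 1 :: real)) ` V) = CARD('n) + 1"
    using cardV by (subst card_image) (auto intro: inj_onI)
  then have "UNIV \<subseteq> span ((\<lambda>u. (u, 1 :: real)) ` V)"
    using homogenized_independent by (intro card_ge_dim_independent) auto
  then show ?thesis by blast
qed

lemma coord_expand: "Z = (\<Sum>u\<in>V. coord u Z *\<^sub>R (u, 1))"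
proof (rule linear_eq_on_span[where f = "\<lambda>Z. Z"
      and g = "\<lambda>Z. \<Sum>u\<in>V. coord u Z *\<^sub>R (u, 1)" and B = "(\<lambda>u. (u, 1 :: real)) ` V"])
  show "linear (\<lambda>Z :: (real^'n) \<times> real. Z)"
    by (rule linear_id[unfolded id_def])
  show "linear (\<lambda>Z. \<Sum>u\<in>V. coord u Z *\<^sub>R (u, 1 :: real))"
    by (intro linearI)
       (simp_all add: coord_simps scaleR_add_left sum.distrib scaleR_sum_right del: scaleR_Pair)
  show "Z \<in> span ((\<lambda>u. (u, 1 :: real)) ` V)"
    by (simp add: span_homogenized)
  show "Z = (\<Sum>u\<in>V. coord u Z *\<^sub>R (u, 1 :: real))" if "Z \<in> (\<lambda>u. (u, 1 :: real)) ` V" for Z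
  proof -
    from that obtain w where w: "w \<in> V" "Z = (w, 1)" by auto
    have "(\<Sum>u\<in>V. coord u (w, 1) *\<^sub>R (u, 1 :: real)) = (\<Sum>u\<in>V. if w = u then (u, 1) else 0)"
      by (intro sum.cong) (auto simp: coord_vertex w zero_prod_def)
    then show ?thesis using w finV by simp
  qed
qed

lemma coord_expand_fst: "x = (\<Sum>u\<in>V. coord u (x, t) *\<^sub>R u)"
  using arg_cong[OF coord_expand[of "(x, t)"], of fst] by (simp add: fst_sum)

lemma sum_coord: "(\<Sum>u\<in>V. coord u Z) = snd Z"
  using arg_cong[OF coord_expand[of Z], of snd] by (simp add: snd_sum)

lemma coord_combination:
  assumes "u \<in> V" shows "coord u (\<Sum>w\<in>V. x w *\<^sub>R (w, 1)) = x u"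
proof -
  have "coord u (\<Sum>w\<in>V. x w *\<^sub>R (w, 1)) = (\<Sum>w\<in>V. x w * coord u (w, 1))"
    by (simp add: coord_simps del: scaleR_Pair)
  also have "\<dots> = (\<Sum>w\<in>V. if w = u then x w else 0)"
    by (intro sum.cong) (auto simp: coord_vertex)
  finally show ?thesis using assms finV by simp
qed

lemma coord_inject: "(\<And>u. u \<in> V \<Longrightarrow> coord u Y = coord u Z) \<Longrightarrow> Y = Z"
  using coord_expand[of Y] coord_expand[of Z] by (metis (no_types, lifting) sum.cong)

lemma hull_iff: "x \<in> convex hull V \<longleftrightarrow> (\<forall>u\<in>V. 0 \<le> coord u (x, 1))"
proof
  assume "x \<in> convex hull V"
  then obtain c where c: "\<forall>u\<in>V. 0 \<le> c u" "sum c V = 1" "(\<Sum>u\<in>V. c u *\<^sub>R u) = x"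
    unfolding convex_hull_finite[OF finV] by blast
  have "(x, 1) = (\<Sum>w\<in>V. c w *\<^sub>R (w, 1 :: real))"
    using c by (simp add: prod_eq_iff fst_sum snd_sum)
  with c(1) show "\<forall>u\<in>V. 0 \<le> coord u (x, 1)"
    by (metis coord_combination)
next
  assume "\<forall>u\<in>V. 0 \<le> coord u (x, 1)"
  then show "x \<in> convex hull V"
    using sum_coord[of "(x, 1)"] coord_expand_fst[of x 1]
    unfolding convex_hull_finite[OF finV] by (auto intro!: exI[of _ "\<lambda>u. coord u (x, 1)"])
qed

lemma interior_hull_iff: "x \<in> interior (convex hull V) \<longleftrightarrow> (\<forall>u\<in>V. 0 < coord u (x, 1))"
proof -
  have *: "interior (convex hull V) =
     {y. \<exists>c. (\<forall>u\<in>V. 0 < c u) \<and> sum c V = 1 \<and> (\<Sum>u\<in>V. c u *\<^sub>R u) = y}"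
    using interior_convex_hull_explicit_minimal[OF indep] cardV by simp
  show ?thesis
  proof
    assume "x \<in> interior (convex hull V)"
    then obtain c where c: "\<forall>u\<in>V. 0 < c u" "sum c V = 1" "(\<Sum>u\<in>V. c u *\<^sub>R u) = x"
      unfolding * by blast
    have "(x, 1) = (\<Sum>w\<in>V. c w *\<^sub>R (w, 1 :: real))"
      using c by (simp add: prod_eq_iff fst_sum snd_sum)
    with c(1) show "\<forall>u\<in>V. 0 < coord u (x, 1)"
      by (metis coord_combination)
  next
    assume "\<forall>u\<in>V. 0 < coord u (x, 1)"
    then show "x \<in> interior (convex hull V)"
      using sum_coord[of "(x, 1)"] coord_expand_fst[of x 1]
      unfolding * by (auto intro!: exI[of _ "\<lambda>u. coord u (x, 1)"])
  qed
qed

definition int_pts :: "((real^'n) \<times> real) set" where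
  "int_pts = int_lattice \<times> \<int>"

lemma int_pts_vertex: "u \<in> V \<Longrightarrow> (u, 1) \<in> int_pts"
  using latV by (auto simp: int_pts_def)

lemma int_pts_add: "Y \<in> int_pts \<Longrightarrow> Z \<in> int_pts \<Longrightarrow> Y + Z \<in> int_pts"
  by (auto simp: int_pts_def int_lattice_add)

lemma int_pts_diff: "Y \<in> int_pts \<Longrightarrow> Z \<in> int_pts \<Longrightarrow> Y - Z \<in> int_pts"
  by (auto simp: int_pts_def int_lattice_diff)

lemma int_pts_scale: "k \<in> \<int> \<Longrightarrow> Z \<in> int_pts \<Longrightarrow> k *\<^sub>R Z \<in> int_pts"
  by (auto simp: int_pts_def int_lattice_scaleR)

lemma int_pts_sum: "(\<And>i. i \<in> A \<Longrightarrow> f i \<in> int_pts) \<Longrightarrow> sum f A \<in> int_pts"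
  by (auto simp: int_pts_def mem_Times_iff fst_sum snd_sum int_lattice_sum)

lemma int_pts_scale_vertex: "k \<in> \<int> \<Longrightarrow> u \<in> V \<Longrightarrow> k *\<^sub>R (u, 1) \<in> int_pts"
  by (intro int_pts_scale int_pts_vertex)

lemma other_vertex:
  assumes "u \<in> V" obtains v where "v \<in> V" "v \<noteq> u"
proof -
  have "card (V - {u}) \<noteq> 0" using assms finV cardV by (simp add: card_Diff_singleton)
  then have "V - {u} \<noteq> {}" by (metis card.empty)
  then show ?thesis using that by blast
qed

text \<open>
  The gradient of the barycentric coordinate at \<open>u\<close>: a normal of the facet opposite to \<open>u\<close>.
\<close>

definition covector :: "real^'n \<Rightarrow> real^'n" where
  "covector u = (\<chi> i. coord u (axis i 1, 0))"

lemma covector_inner: "covector u \<bullet> x = coord u (x, 0)"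
proof -
  have "(x, 0) = (\<Sum>i\<in>UNIV. x $ i *\<^sub>R (axis i 1 :: real^'n, 0 :: real))"
    using basis_expansion[of x] by (simp add: prod_eq_iff fst_sum snd_sum scalar_mult_eq_scaleR)
  then have "coord u (x, 0) = (\<Sum>i\<in>UNIV. x $ i * coord u (axis i 1, 0))"
    by (simp add: coord_simps del: scaleR_Pair)
  then show ?thesis by (simp add: covector_def inner_vec_def mult.commute)
qed

end

section \<open>Volumes of fundamental domains and of linear preimages\<close>

lemma nn_integral_lborel_shift:
  fixes a :: "'a::euclidean_space"
  assumes [measurable]: "f \<in> borel_measurable borel"
  shows "(\<integral>\<^sup>+x. f (x + a) \<partial>lborel) = (\<integral>\<^sup>+x. f x \<partial>lborel)"
proof -
  have "(\<integral>\<^sup>+x. f x \<partial>lborel) = (\<integral>\<^sup>+x. f x \<partial>distr lborel borel ((+) a))"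
    by (simp add: lborel_distr_plus)
  also have "\<dots> = (\<integral>\<^sup>+x. f (a + x) \<partial>lborel)"
    by (subst nn_integral_distr) auto
  finally show ?thesis by (simp add: add.commute)
qed

lemma emeasure_lborel_shift:
  fixes a :: "'a::euclidean_space"
  assumes [measurable]: "A \<in> sets borel"
  shows "emeasure lborel {x. x + a \<in> A} = emeasure lborel A"
proof -
  have "emeasure lborel {x. x + a \<in> A} = (\<integral>\<^sup>+x. indicator {x. x + a \<in> A} x \<partial>lborel)"
    by (rule nn_integral_indicator[symmetric]) measurable
  also have "\<dots> = (\<integral>\<^sup>+x. indicator A (x + a) \<partial>lborel)"
    by (simp add: indicator_def)
  also have "\<dots> = (\<integral>\<^sup>+x. indicator A x \<partial>lborel)"
    by (rule nn_integral_lborel_shift) measurable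
  finally show ?thesis by simp
qed

text \<open>
  This is the uniqueness argument for translation invariant measures: both sides are the double
  integral of \<open>1\<^sub>A(x) 1\<^sub>B(x + g y)\<close>. Integrating over \<open>y\<close> first gives the left side. Substituting
  \<open>x - g y\<close> for \<open>x\<close> and then integrating over \<open>y\<close> gives the right side up to a reflection of \<open>A\<close>.
  So linear maps scale volume without any determinant being computed.
\<close>

lemma emeasure_linear_vimage_proportional:
  fixes g :: "'a::euclidean_space \<Rightarrow> 'a"
  assumes g: "linear g" and bij: "bij g"
    and A: "A \<in> sets borel" and sym: "\<And>x. - x \<in> A \<longleftrightarrow> x \<in> A" and B: "B \<in> sets borel"
  shows "emeasure lborel A * emeasure lborel (g -` B) =
    emeasure lborel (g -` A) * emeasure lborel B"
proof -
  have [measurable]: "g \<in> borel_measurable borel"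
    using g by (intro borel_measurable_continuous_onI linear_continuous_on)
      (simp add: linear_conv_bounded_linear)
  note [measurable] = A B
  obtain h where gh: "\<And>x. g (h x) = x"
    using bij by (metis bij_pointE)
  have vim: "emeasure lborel (g -` X) = (\<integral>\<^sup>+y. indicator X (g y) \<partial>lborel)"
    if X: "X \<in> sets borel" for X
  proof -
    have "g -` X \<in> sets lborel"
      using X by (auto intro: measurable_sets_borel[of g borel])
    then have "emeasure lborel (g -` X) = (\<integral>\<^sup>+y. indicator (g -` X) y \<partial>lborel)"
      by (rule nn_integral_indicator[symmetric])
    then show ?thesis by (simp add: indicator_def)
  qed
  have shift: "(\<integral>\<^sup>+y. indicator X (x + g y) \<partial>lborel) = emeasure lborel (g -` X)"
    if X[measurable]: "X \<in> sets borel" for X x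
  proof -
    have "(\<integral>\<^sup>+y. indicator X (x + g y) \<partial>lborel) = (\<integral>\<^sup>+y. indicator X (g (y + h x)) \<partial>lborel)"
      by (simp add: linear_add[OF g] gh add.commute)
    also have "\<dots> = (\<integral>\<^sup>+y. indicator X (g y) \<partial>lborel)"
      by (rule nn_integral_lborel_shift[of "\<lambda>y. indicator X (g y)"]) measurable
    finally show ?thesis by (simp add: vim X)
  qed
  have "emeasure lborel A * emeasure lborel (g -` B) =
      (\<integral>\<^sup>+x. indicator A x * emeasure lborel (g -` B) \<partial>lborel)"
    by (subst nn_integral_multc) auto
  also have "\<dots> = (\<integral>\<^sup>+x. (\<integral>\<^sup>+y. indicator A x * indicator B (x + g y) \<partial>lborel) \<partial>lborel)"
    by (intro nn_integral_cong, subst nn_integral_cmult) (auto simp: shift B)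
  also have "\<dots> = (\<integral>\<^sup>+y. (\<integral>\<^sup>+x. indicator A x * indicator B (x + g y) \<partial>lborel) \<partial>lborel)"
    by (rule lborel_pair.Fubini'[symmetric]) measurable
  also have "\<dots> = (\<integral>\<^sup>+y. (\<integral>\<^sup>+x. indicator A (x - g y) * indicator B x \<partial>lborel) \<partial>lborel)"
  proof (rule nn_integral_cong)
    fix y
    have "(\<integral>\<^sup>+x. indicator A (x + g y - g y) * indicator B (x + g y) \<partial>lborel)
        = (\<integral>\<^sup>+x. indicator A (x - g y) * indicator B x \<partial>lborel :: ennreal)"
      by (rule nn_integral_lborel_shift[of "\<lambda>x. indicator A (x - g y) * indicator B x :: ennreal"])
        measurable
    then show "(\<integral>\<^sup>+x. indicator A x * indicator B (x + g y) \<partial>lborel)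
        = (\<integral>\<^sup>+x. indicator A (x - g y) * indicator B x \<partial>lborel :: ennreal)" by simp
  qed
  also have "\<dots> = (\<integral>\<^sup>+x. (\<integral>\<^sup>+y. indicator A (x - g y) * indicator B x \<partial>lborel) \<partial>lborel)"
    by (rule lborel_pair.Fubini') measurable
  also have "\<dots> = (\<integral>\<^sup>+x. (\<integral>\<^sup>+y. indicator A (- x + g y) \<partial>lborel) * indicator B x \<partial>lborel)"
  proof (rule nn_integral_cong)
    fix x
    have "indicator A (x - g y) = (indicator A (- x + g y) :: ennreal)" for y
      using sym[of "x - g y"] by (simp add: indicator_def)
    then show "(\<integral>\<^sup>+y. indicator A (x - g y) * indicator B x \<partial>lborel) =
        (\<integral>\<^sup>+y. indicator A (- x + g y) \<partial>lborel) * (indicator B x :: ennreal)"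
      by (subst nn_integral_multc[symmetric]) auto
  qed
  also have "\<dots> = (\<integral>\<^sup>+x. emeasure lborel (g -` A) * indicator B x \<partial>lborel)"
    by (simp only: shift[OF A])
  also have "\<dots> = emeasure lborel (g -` A) * emeasure lborel B"
    by (subst nn_integral_cmult) auto
  finally show ?thesis .
qed

text \<open>
  The symmetric set in the previous lemma only serves as a yardstick with positive finite measure, so
  it cancels: a linear bijection scales all volumes by the factor it has on a set \<open>C\<close> of volume \<open>1\<close>.
\<close>

lemma emeasure_linear_vimage:
  fixes g :: "'a::euclidean_space \<Rightarrow> 'a"
  assumes g: "linear g" "bij g" and B: "B \<in> sets borel"
    and C: "C \<in> sets borel" "emeasure lborel C = 1"
  shows "emeasure lborel (g -` B) = emeasure lborel (g -` C) * emeasure lborel B"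
proof -
  \<comment> \<open>Any symmetric Borel set of positive finite measure would do.\<close>
  define D where "D = cbox (- One) (One :: 'a)"
  have sym: "- x \<in> D \<longleftrightarrow> x \<in> D" for x
    by (auto simp: D_def mem_box)
  note * = emeasure_linear_vimage_proportional[OF g _ sym]
  have D: "emeasure lborel D \<noteq> 0" "emeasure lborel D \<noteq> \<infinity>"
    by (simp_all add: D_def emeasure_lborel_cbox_eq inner_add_left)
  have "emeasure lborel D * emeasure lborel (g -` B) =
      emeasure lborel D * (emeasure lborel (g -` C) * emeasure lborel B)"
    using *[OF _ B] *[OF _ C(1)] C(2) by (simp add: D_def mult.assoc[symmetric])
  then show ?thesis
    using D by (simp add: ennreal_mult_cancel_left)
qed

text \<open>
  Two fundamental domains, \<open>C\<close> for the group \<open>I\<close> and \<open>P\<close> for the subgroup \<open>M\<close>: cutting \<open>P\<close> along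
  the translates of \<open>C\<close> and moving the pieces back into \<open>C\<close> covers each point \<open>x\<close> of \<open>C\<close> once for
  every \<open>z \<in> I\<close> with \<open>x + z \<in> P\<close>. Each coset of \<open>M\<close> in \<open>I\<close> contributes exactly one such \<open>z\<close>, and
  exactly one point of \<open>P \<inter> I\<close>, so the number of layers is the index of \<open>M\<close> in \<open>I\<close>.
\<close>

lemma emeasure_fundamental_domain:
  fixes P C :: "'a::euclidean_space set"
  assumes [measurable]: "P \<in> sets borel" "C \<in> sets borel"
    and I: "countable I" "\<And>x y. x \<in> I \<Longrightarrow> y \<in> I \<Longrightarrow> x - y \<in> I" "0 \<in> I"
    and M: "M \<subseteq> I" "\<And>x y. x \<in> M \<Longrightarrow> y \<in> M \<Longrightarrow> x - y \<in> M" "0 \<in> M"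
    and tileC: "\<And>x. \<exists>!z. z \<in> I \<and> x - z \<in> C"
    and tileP: "\<And>x. \<exists>!m. m \<in> M \<and> x - m \<in> P"
  shows "emeasure lborel P = emeasure (count_space UNIV) (P \<inter> I) * emeasure lborel C"
proof -
  have addI: "x + y \<in> I" if "x \<in> I" "y \<in> I" for x y
    using I(2)[OF that(1) I(2)[OF I(3) that(2)]] by simp
  have count: "emeasure (count_space I) {z \<in> I. x + z \<in> P} = emeasure (count_space UNIV) (P \<inter> I)" for x
  proof -
    obtain m where m: "\<And>y. m y \<in> M \<and> y - m y \<in> P"
      using tileP by metis
    have uniq: "n = n'" if "n \<in> M" "n' \<in> M" "y - n \<in> P" "y - n' \<in> P" for y n n'
      using tileP[of y] that by auto
    \<comment> \<open>Here \<open>m y\<close> is the element of \<open>M\<close> that moves \<open>y\<close> into \<open>P\<close>.\<close>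
    have bij: "bij_betw (\<lambda>r. r - m (x + r)) (P \<inter> I) {z \<in> I. x + z \<in> P}"
      unfolding bij_betw_def
    proof
      show "inj_on (\<lambda>r. r - m (x + r)) (P \<inter> I)"
      proof (rule inj_onI)
        fix r s assume r: "r \<in> P \<inter> I" and s: "s \<in> P \<inter> I" and eq: "r - m (x + r) = s - m (x + s)"
        have "r - s = m (x + r) - m (x + s)" using eq by (simp add: algebra_simps)
        then have "r - s \<in> M" using m M(2) by metis
        then have "r - s = 0"
          using r s M(3) by (intro uniq[of "r - s" 0 r]) auto
        then show "r = s" by simp
      qed
      show "(\<lambda>r. r - m (x + r)) ` (P \<inter> I) = {z \<in> I. x + z \<in> P}"
      proof (intro equalityI subsetI)
        fix z assume "z \<in> (\<lambda>r. r - m (x + r)) ` (P \<inter> I)"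
        then show "z \<in> {z \<in> I. x + z \<in> P}"
          using m M(1) I(2) by (auto simp: add_diff_eq)
      next
        fix z assume z: "z \<in> {z \<in> I. x + z \<in> P}"
        define n where "n = m z"
        have n: "n \<in> M" "z - n \<in> P" using m by (auto simp: n_def)
        have "0 - n \<in> M" using M(2)[OF M(3) n(1)] .
        moreover have "x + (z - n) - (0 - n) \<in> P" using z by simp
        ultimately have "m (x + (z - n)) = 0 - n"
          using m[of "x + (z - n)"] by (intro uniq) auto
        then have "z = (z - n) - m (x + (z - n))" by simp
        moreover have "z - n \<in> P \<inter> I" using n z M(1) I(2) by auto
        ultimately show "z \<in> (\<lambda>r. r - m (x + r)) ` (P \<inter> I)" by blast
      qed
    qed
    show ?thesis
      using bij_betw_finite[OF bij] bij_betw_same_card[OF bij]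
      by (simp add: emeasure_count_space)
  qed
  have "P = (\<Union>z\<in>I. {x \<in> P. x - z \<in> C})"
    using tileC by blast
  also have "emeasure lborel \<dots> = (\<integral>\<^sup>+z. emeasure lborel {x \<in> P. x - z \<in> C} \<partial>count_space I)"
  proof (rule emeasure_UN_countable)
    show "disjoint_family_on (\<lambda>z. {x \<in> P. x - z \<in> C}) I"
      using tileC by (fastforce simp: disjoint_family_on_def)
  qed (use I in auto)
  also have "\<dots> = (\<integral>\<^sup>+z. (\<integral>\<^sup>+x. indicator C x * indicator P (x + z) \<partial>lborel) \<partial>count_space I)"
  proof (rule nn_integral_cong)
    fix z
    have "emeasure lborel {x \<in> P. x - z \<in> C} = emeasure lborel {x. x + z \<in> {x \<in> P. x - z \<in> C}}"
      by (rule emeasure_lborel_shift[symmetric]) measurable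
    also have "\<dots> = (\<integral>\<^sup>+x. indicator {x. x + z \<in> {x \<in> P. x - z \<in> C}} x \<partial>lborel)"
      by (rule nn_integral_indicator[symmetric]) measurable
    finally show "emeasure lborel {x \<in> P. x - z \<in> C} =
        (\<integral>\<^sup>+x. indicator C x * indicator P (x + z) \<partial>lborel)"
      by (simp add: indicator_def[abs_def] if_distrib cong: if_cong)
         (auto intro!: nn_integral_cong)
  qed
  also have "\<dots> = (\<integral>\<^sup>+x. (\<integral>\<^sup>+z. indicator C x * indicator P (x + z) \<partial>count_space I) \<partial>lborel)"
    using I(1) by (intro nn_integral_count_space_nn_integral[symmetric]) auto
  also have "\<dots> = (\<integral>\<^sup>+x. emeasure (count_space UNIV) (P \<inter> I) * indicator C x \<partial>lborel)"
  proof (rule nn_integral_cong)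
    fix x
    have "(\<integral>\<^sup>+z. indicator P (x + z) \<partial>count_space I) =
        (\<integral>\<^sup>+z. indicator {z \<in> I. x + z \<in> P} z \<partial>count_space I)"
      by (intro nn_integral_cong) (auto simp: indicator_def)
    then show "(\<integral>\<^sup>+z. indicator C x * indicator P (x + z) \<partial>count_space I) =
        emeasure (count_space UNIV) (P \<inter> I) * indicator C x"
      by (simp add: nn_integral_cmult count mult.commute)
  qed
  also have "\<dots> = emeasure (count_space UNIV) (P \<inter> I) * emeasure lborel C"
    by (subst nn_integral_cmult) auto
  finally show ?thesis .
qed

definition unit_cube :: "(real^'n) set" where
  "unit_cube = {x. \<forall>i. 0 \<le> x $ i \<and> x $ i < 1}"

lemma unit_cube_borel: "unit_cube \<in> sets borel"
proof -
  have "unit_cube = (\<Inter>i. (\<lambda>x. x $ i) -` {0..<1})"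
    by (auto simp: unit_cube_def)
  also have "\<dots> \<in> sets borel"
    by (intro sets.finite_INT measurable_sets_borel[where M = borel]) auto
  finally show ?thesis .
qed

lemma emeasure_unit_cube: "emeasure lborel (unit_cube :: (real^'n) set) = 1"
proof (rule antisym)
  have one: "(One :: real^'n) $ i = 1" for i :: 'n
  proof -
    have "(One :: real^'n) $ i = One \<bullet> axis i (1 :: real)" by (rule cart_eq_inner_axis)
    also have "\<dots> = 1" by (rule inner_sum_Basis) simp
    finally show ?thesis .
  qed
  have "emeasure lborel (unit_cube :: (real^'n) set) \<le> emeasure lborel (cbox 0 (One :: real^'n))"
    using one by (intro emeasure_mono) (auto simp: unit_cube_def mem_box_cart less_imp_le)
  also have "\<dots> = 1" by (subst emeasure_lborel_cbox) auto
  finally show "emeasure lborel (unit_cube :: (real^'n) set) \<le> 1" .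
  have "1 = emeasure lborel (box 0 (One :: real^'n))"
    by (subst emeasure_lborel_box) auto
  also have "\<dots> \<le> emeasure lborel (unit_cube :: (real^'n) set)"
    using one unit_cube_borel by (intro emeasure_mono) (auto simp: unit_cube_def mem_box_cart less_imp_le)
  finally show "1 \<le> emeasure lborel (unit_cube :: (real^'n) set)" .
qed

lemma countable_int_lattice: "countable (int_lattice :: (real^'n) set)"
proof -
  have "int_lattice \<subseteq> range (\<lambda>f :: int^'n. (\<chi> i. of_int (f $ i)) :: real^'n)"
  proof
    fix x :: "real^'n" assume "x \<in> int_lattice"
    then have "x = (\<chi> i. of_int ((\<chi> i. \<lfloor>x $ i\<rfloor>) $ i))"
      by (simp add: int_lattice_def vec_eq_iff)
    then show "x \<in> range (\<lambda>f :: int^'n. (\<chi> i. of_int (f $ i)) :: real^'n)" by blast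
  qed
  moreover have "countable (UNIV :: (int^'n) set)" by simp
  ultimately show ?thesis by (meson countable_image countable_subset)
qed

lemma unit_cube_tiles: "\<exists>!z. z \<in> int_lattice \<and> x - z \<in> unit_cube"
proof (rule ex1I[of _ "\<chi> i. of_int \<lfloor>x $ i\<rfloor>"])
  show "(\<chi> i. of_int \<lfloor>x $ i\<rfloor>) \<in> int_lattice \<and> x - (\<chi> i. of_int \<lfloor>x $ i\<rfloor>) \<in> unit_cube"
    by (auto simp: int_lattice_def unit_cube_def) linarith
next
  fix z assume z: "z \<in> int_lattice \<and> x - z \<in> unit_cube"
  have "z $ i = of_int \<lfloor>x $ i\<rfloor>" for i
  proof -
    obtain k where "z $ i = of_int k" using z by (auto simp: int_lattice_def elim: Ints_cases)
    moreover have "0 \<le> x $ i - z $ i" "x $ i - z $ i < 1" using z by (auto simp: unit_cube_def)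
    ultimately show ?thesis by (simp, linarith)
  qed
  then show "z = (\<chi> i. of_int \<lfloor>x $ i\<rfloor>)" by (simp add: vec_eq_iff)
qed

section \<open>The order of the group is the normalized volume\<close>

lemma frac_eq_iff_diff_Ints: "frac x = frac y \<longleftrightarrow> x - y \<in> \<int>" for x y :: real
proof
  assume "frac x = frac y"
  then have "x - y = of_int (\<lfloor>x\<rfloor> - \<lfloor>y\<rfloor>)"
    by (simp add: frac_def)
  then show "x - y \<in> \<int>" by (metis Ints_of_int)
next
  assume "x - y \<in> \<int>"
  then obtain k where "x = y + of_int k"
    by (metis Ints_cases diff_eq_eq add.commute)
  then show "frac x = frac y" by (simp add: frac_def)
qed

lemma sum_Basis_cart: "sum f (Basis :: (real^'n) set) = (\<Sum>i\<in>UNIV. f (axis i 1))"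
proof -
  have "(Basis :: (real^'n) set) = range (\<lambda>i. axis i 1)"
    by (auto simp: Basis_vec_def)
  moreover have "inj (\<lambda>i. axis i 1 :: real^'n)"
    by (auto intro: injI simp: axis_eq_axis)
  ultimately show ?thesis
    using sum.reindex[of "\<lambda>i. axis i 1" UNIV f] by (simp only: o_def)
qed

lemma std_simplex_cart:
  "x \<in> convex hull (insert 0 Basis) \<longleftrightarrow> (\<forall>i. 0 \<le> x $ i) \<and> (\<Sum>i\<in>UNIV. x $ i) \<le> 1"
  for x :: "real^'n"
proof -
  have "(\<forall>b\<in>Basis. 0 \<le> x \<bullet> b) \<longleftrightarrow> (\<forall>i. 0 \<le> x $ i)"
    by (auto simp: Basis_vec_def inner_axis)
  then show ?thesis
    by (simp add: std_simplex sum_Basis_cart inner_axis)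
qed

context lattice_simplex_vertices
begin

text \<open>
  Coordinates modulo \<open>1\<close>, represented in \<open>[0, 1)\<close>. The image of the integer points is a copy of the
  group \<open>\<Lambda>\<^sub>\<Delta>\<close> that does not refer to an ordering of the vertices.
\<close>

definition fracs :: "(real^'n) \<times> real \<Rightarrow> real^'n \<Rightarrow> real" where
  "fracs Z = (\<lambda>u\<in>V. frac (coord u Z))"

lemma fracs_eq_iff: "fracs Y = fracs Z \<longleftrightarrow> (\<forall>u\<in>V. coord u Y - coord u Z \<in> \<int>)"
  by (auto simp: fracs_def restrict_def fun_eq_iff frac_eq_iff_diff_Ints)

text \<open>
  Take one vertex as origin and the other barycentric coordinates as linear coordinates \<open>g\<close>. Then \<open>g\<close>
  maps the simplex to the standard simplex, of volume \<open>1 / d!\<close>, and the half-open parallelepiped \<open>P\<close>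
  spanned by the edges to the unit cube; so the volume of \<open>P\<close> is the normalized volume. As \<open>P\<close> is a
  fundamental domain for the lattice spanned by the edges, its volume is also the number of its
  integer points, and these represent each element of the group once.
\<close>

lemma normalized_volume_eq_card:
  "normalized_volume (convex hull V) = card (fracs ` int_pts)"
proof -
  obtain v0 where v0: "v0 \<in> V"
    using cardV by (metis card.empty ex_in_conv add_is_0 one_neq_zero)
  define W where "W = V - {v0}"
  have W: "finite W" "card W = CARD('n)" "V = insert v0 W" "v0 \<notin> W"
    using v0 finV cardV by (auto simp: W_def card_Diff_singleton)
  obtain b where b: "bij_betw b (UNIV :: 'n set) W"
    using W by (metis finite_same_card_bij finite_class.finite_UNIV)
  have bW: "b i \<in> W" for i using b by (auto simp: bij_betw_def)
  define g :: "real^'n \<Rightarrow> real^'n" where "g x = (\<chi> i. coord (b i) (x, 0))" for x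
  have all_W: "(\<forall>i. Q (b i)) \<longleftrightarrow> (\<forall>u\<in>W. Q u)" for Q
    using b by (auto simp: bij_betw_def)
  have g: "linear g"
    using coord_add[of _ _ _ 0 0] coord_scale[of _ _ _ 0]
    by (auto intro!: linearI simp: g_def vec_eq_iff)
  have sum0: "coord v0 (x, 0) = - (\<Sum>u\<in>W. coord u (x, 0))" for x
    using sum_coord[of "(x, 0)"] W by simp
  have inj0: "x = y" if eqW: "\<And>u. u \<in> W \<Longrightarrow> coord u (x, 0) = coord u (y, 0)" for x y
  proof -
    have "coord u (x, 0) = coord u (y, 0)" if "u \<in> V" for u
    proof (cases "u = v0")
      case True
      then show ?thesis using eqW by (simp add: sum0)
    qed (use that W eqW in auto)
    then have "(x, 0 :: real) = (y, 0)" by (rule coord_inject)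
    then show ?thesis by simp
  qed
  have "inj g"
  proof (rule injI)
    fix x y assume "g x = g y"
    then have "\<forall>i. coord (b i) (x, 0) = coord (b i) (y, 0)"
      by (simp add: g_def vec_eq_iff)
    then show "x = y"
      using all_W[of "\<lambda>u. coord u (x, 0) = coord u (y, 0)"] inj0 by blast
  qed
  then have bij: "bij g"
    using g by (simp add: bij_def linear_injective_imp_surjective)
  define P where "P = g -` unit_cube"
  have P_iff: "x \<in> P \<longleftrightarrow> (\<forall>u\<in>W. 0 \<le> coord u (x, 0) \<and> coord u (x, 0) < 1)" for x
    using all_W[of "\<lambda>u. 0 \<le> coord u (x, 0) \<and> coord u (x, 0) < 1"]
    by (simp add: P_def g_def unit_cube_def)
  define I where "I = (int_lattice :: (real^'n) set)"
  define M where "M = {z \<in> I. \<forall>u\<in>W. coord u (z, 0) \<in> \<int>}"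
  define R where "R = P \<inter> I"
  \<comment> \<open>Rounding the coordinates down moves \<open>x\<close> into \<open>P\<close> by an element of the edge lattice.\<close>
  define m where "m x = (\<Sum>u\<in>W. of_int \<lfloor>coord u (x, 0)\<rfloor> *\<^sub>R (u - v0))" for x
  have coord_m: "coord u (m x, 0) = of_int \<lfloor>coord u (x, 0)\<rfloor>" if "u \<in> W" for u x
  proof -
    have "(m x, 0) = (\<Sum>w\<in>W. of_int \<lfloor>coord w (x, 0)\<rfloor> *\<^sub>R ((w, 1) - (v0, 1 :: real)))"
      by (simp add: m_def prod_eq_iff fst_sum snd_sum)
    then have "coord u (m x, 0) = (\<Sum>w\<in>W. of_int \<lfloor>coord w (x, 0)\<rfloor> * (coord u (w, 1) - coord u (v0, 1)))"
      by (simp add: coord_simps del: scaleR_Pair diff_Pair)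
    also have "\<dots> = (\<Sum>w\<in>W. if w = u then of_int \<lfloor>coord w (x, 0)\<rfloor> else 0)"
    proof (intro sum.cong refl)
      fix w assume "w \<in> W"
      then have "coord u (w, 1) - coord u (v0, 1) = (if w = u then 1 else 0)"
        using that v0 coord_vertex[of w u] coord_vertex[of v0 u] by (auto simp: W_def)
      then show "of_int \<lfloor>coord w (x, 0)\<rfloor> * (coord u (w, 1) - coord u (v0, 1)) =
          (if w = u then of_int \<lfloor>coord w (x, 0)\<rfloor> else 0)"
        by simp
    qed
    finally show ?thesis using W that by simp
  qed
  have m: "m x \<in> M" for x
    unfolding M_def using latV W coord_m
    by (auto simp: m_def I_def intro!: int_lattice_sum int_lattice_scaleR int_lattice_diff)
  have tileP: "\<exists>!n. n \<in> M \<and> x - n \<in> P" for x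
  proof (rule ex1I[of _ "m x"])
    have "coord u (x - m x, 0) = coord u (x, 0) - of_int \<lfloor>coord u (x, 0)\<rfloor>" if "u \<in> W" for u
      using coord_diff[of u x "m x" 0 0] coord_m[OF that] by simp
    then show "m x \<in> M \<and> x - m x \<in> P"
      using m by (auto simp: P_iff) linarith
  next
    fix n assume n: "n \<in> M \<and> x - n \<in> P"
    show "n = m x"
    proof (rule inj0)
      fix u assume u: "u \<in> W"
      then obtain k where k: "coord u (n, 0) = of_int k" using n by (auto simp: M_def elim: Ints_cases)
      moreover have "0 \<le> coord u (x, 0) - coord u (n, 0)" "coord u (x, 0) - coord u (n, 0) < 1"
        using n u coord_diff[of u x n 0 0] by (auto simp: P_iff)
      ultimately have "k = \<lfloor>coord u (x, 0)\<rfloor>" by linarith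
      then show "coord u (n, 0) = coord u (m x, 0)" using k coord_m[OF u] by simp
    qed
  qed
  have gmeas: "g \<in> borel_measurable borel"
    using g by (intro borel_measurable_continuous_onI linear_continuous_on)
      (simp add: linear_conv_bounded_linear)
  have P: "P \<in> sets borel"
    unfolding P_def by (rule measurable_sets_borel[OF gmeas unit_cube_borel])
  have 1: "emeasure lborel P = emeasure (count_space UNIV) R"
  proof -
    have "emeasure lborel P = emeasure (count_space UNIV) (P \<inter> I) * emeasure lborel (unit_cube :: (real^'n) set)"
    proof (rule emeasure_fundamental_domain[OF P unit_cube_borel])
      show "M \<subseteq> I" "0 \<in> I" "0 \<in> M"
        using coord_simps(5) by (auto simp: M_def I_def int_lattice_zero zero_prod_def)
      show "x - y \<in> M" if "x \<in> M" "y \<in> M" for x y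
        using that coord_diff[of _ x y 0 0] by (auto simp: M_def I_def int_lattice_diff)
      show "\<exists>!z. z \<in> I \<and> x - z \<in> unit_cube" for x
        unfolding I_def by (rule unit_cube_tiles)
      show "\<exists>!n. n \<in> M \<and> x - n \<in> P" for x
        by (rule tileP)
    qed (simp_all add: I_def countable_int_lattice int_lattice_diff)
    then show ?thesis by (simp add: emeasure_unit_cube R_def)
  qed
  let ?D = "convex hull V"
  have compact: "compact ?D" by (rule finite_imp_compact_convex_hull[OF finV])
  then have D: "?D \<in> sets borel" by (simp add: compact_imp_closed)
  have "{x. x + v0 \<in> ?D} = g -` (convex hull (insert 0 Basis))"
  proof (rule Set.set_eqI)
    fix x
    have 2: "coord u (x + v0, 1) = coord u (x, 0) + (if u = v0 then 1 else 0)" for u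
      using coord_add[of u x v0 0 1] coord_vertex[OF v0, of u] by auto
    have "(\<Sum>i\<in>UNIV. g x $ i) = (\<Sum>u\<in>W. coord u (x, 0))"
      using sum.reindex_bij_betw[OF b, of "\<lambda>u. coord u (x, 0)"] by (simp add: g_def)
    then have "g x \<in> convex hull (insert 0 Basis) \<longleftrightarrow>
        (\<forall>u\<in>W. 0 \<le> coord u (x, 0)) \<and> (\<Sum>u\<in>W. coord u (x, 0)) \<le> 1"
      using all_W[of "\<lambda>u. 0 \<le> coord u (x, 0)"] by (simp add: std_simplex_cart) (simp add: g_def)
    also have "\<dots> \<longleftrightarrow> x + v0 \<in> ?D"
    proof -
      have "x + v0 \<in> ?D \<longleftrightarrow> 0 \<le> coord v0 (x, 0) + 1 \<and> (\<forall>u\<in>W. 0 \<le> coord u (x, 0) + (if u = v0 then 1 else 0))"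
        unfolding hull_iff 2 using v0 by (auto simp: W_def)
      also have "(\<forall>u\<in>W. 0 \<le> coord u (x, 0) + (if u = v0 then 1 else 0)) \<longleftrightarrow> (\<forall>u\<in>W. 0 \<le> coord u (x, 0))"
        using W(4) by (intro ball_cong) auto
      finally show ?thesis unfolding sum0 by auto
    qed
    finally show "x \<in> {x. x + v0 \<in> ?D} \<longleftrightarrow> x \<in> g -` (convex hull (insert 0 Basis))" by simp
  qed
  then have "emeasure lborel ?D = emeasure lborel (g -` (convex hull (insert 0 Basis)))"
    using emeasure_lborel_shift[OF D, of v0] by simp
  also have "\<dots> = emeasure lborel P * emeasure lborel (convex hull (insert 0 Basis) :: (real^'n) set)"
    unfolding P_def
    by (rule emeasure_linear_vimage[OF g bij _ unit_cube_borel emeasure_unit_cube])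
       (auto intro!: borel_closed compact_imp_closed finite_imp_compact_convex_hull)
  also have "\<dots> = emeasure (count_space UNIV) R * ennreal (1 / fact CARD('n))"
    by (simp add: 1 emeasure_std_simplex)
  finally have 3: "emeasure lborel ?D = emeasure (count_space UNIV) R * ennreal (1 / fact CARD('n))" .
  have fin: "finite R"
  proof (rule ccontr)
    assume "infinite R"
    then have "emeasure lborel ?D = \<infinity>"
      using 3 by (simp add: emeasure_count_space ennreal_top_mult)
    then show False
      using emeasure_bounded_finite[OF compact_imp_bounded[OF compact]] by simp
  qed
  then have "emeasure lborel ?D = ennreal (real (card R) * (1 / fact CARD('n)))"
    using 3 by (simp add: emeasure_count_space ennreal_of_nat_eq_real_of_nat ennreal_mult'[symmetric])
  then have "measure lborel ?D = real (card R) / fact CARD('n)"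
    by (simp add: measure_def)
  moreover have "measure lebesgue ?D = measure lborel ?D"
    using D by (intro measure_completion) simp
  ultimately have 4: "normalized_volume ?D = card R"
    by (simp add: normalized_volume_def)
  have "bij_betw (\<lambda>z. fracs (z, 0)) R (fracs ` int_pts)"
    unfolding bij_betw_def
  proof
    show "inj_on (\<lambda>z. fracs (z, 0)) R"
    proof (intro inj_onI inj0)
      fix y z u assume y: "y \<in> R" and z: "z \<in> R" and eq: "fracs (y, 0) = fracs (z, 0)" and u: "u \<in> W"
      have "u \<in> V" using u by (simp add: W_def)
      then have "frac (coord u (y, 0)) = frac (coord u (z, 0))"
        using fun_cong[OF eq, of u] by (simp add: fracs_def)
      moreover have "frac (coord u (y, 0)) = coord u (y, 0)" "frac (coord u (z, 0)) = coord u (z, 0)"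
        using y z u by (auto simp: R_def P_iff frac_eq)
      ultimately show "coord u (y, 0) = coord u (z, 0)" by simp
    qed
    show "(\<lambda>z. fracs (z, 0)) ` R = fracs ` int_pts"
    proof (intro equalityI subsetI)
      fix f assume "f \<in> (\<lambda>z. fracs (z, 0)) ` R"
      then show "f \<in> fracs ` int_pts"
        by (auto simp: R_def I_def int_pts_def)
    next
      fix f assume "f \<in> fracs ` int_pts"
      then obtain z t where z: "z \<in> int_lattice" "t \<in> \<int>" and f: "f = fracs (z, t)"
        by (auto simp: int_pts_def)
      define y where "y = z - t *\<^sub>R v0"
      have yI: "y \<in> I" using z v0 latV by (auto simp: y_def I_def int_lattice_diff int_lattice_scaleR)
      have mI: "m y \<in> I" using m by (auto simp: M_def)
      have "y - m y \<in> R"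
        using tileP[of y] m[of y] yI mI
          coord_diff[of _ y "m y" 0 0] coord_m
        by (auto simp: R_def I_def P_iff int_lattice_diff) linarith
      moreover have "fracs (z, t) = fracs (y - m y, 0)"
        unfolding fracs_eq_iff
      proof
        fix u assume u: "u \<in> V"
        have "coord u (z, t) - coord u (y - m y, 0) = coord u (t *\<^sub>R v0 + m y, t)"
          using coord_diff[of u z "y - m y" t 0] by (simp add: y_def algebra_simps)
        also have "\<dots> = t * coord u (v0, 1) + coord u (m y, 0)"
          using coord_add[of u "t *\<^sub>R v0" "m y" t 0] coord_scale[of u t v0 1] by simp
        also have "\<dots> \<in> \<int>"
        proof (intro Ints_add Ints_mult z)
          show "coord u (v0, 1) \<in> \<int>" using coord_vertex[OF v0] by simp
          show "coord u (m y, 0) \<in> \<int>"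
            using u W sum0[of "m y"] coord_m by (auto intro!: Ints_minus Ints_sum)
        qed
        finally show "coord u (z, t) - coord u (y - m y, 0) \<in> \<int>" .
      qed
      ultimately show "f \<in> (\<lambda>z. fracs (z, 0)) ` R" using f by blast
    qed
  qed
  then have "card R = card (fracs ` int_pts)" by (rule bij_betw_same_card)
  then show ?thesis using 4 by simp
qed

text \<open>
  Lagrange's theorem for the finite group of coordinate vectors modulo \<open>1\<close>: translation by the class
  of \<open>Z\<close> permutes the group, so the sum of all elements changes by an integer vector, and also by the
  group order times the class of \<open>Z\<close>.
\<close>

lemma card_fracs_annihilates:
  assumes fin: "finite (fracs ` int_pts)" and Z: "Z \<in> int_pts" and u: "u \<in> V"
  shows "real (card (fracs ` int_pts)) * coord u Z \<in> \<int>"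
proof -
  let ?F = "fracs ` int_pts"
  define T where "T f = (\<lambda>w\<in>V. frac (f w + coord w Z))" for f :: "real^'n \<Rightarrow> real"
  have T: "T (fracs Y) = fracs (Y + Z)" for Y
  proof -
    have "frac (frac (coord w Y) + coord w Z) = frac (coord w (Y + Z))" for w
      unfolding frac_eq_iff_diff_Ints by (simp add: coord_simps frac_def)
    then show ?thesis by (simp add: T_def fracs_def restrict_def fun_eq_iff)
  qed
  have "inj_on T ?F"
  proof (rule inj_onI)
    fix f g assume "f \<in> ?F" "g \<in> ?F" "T f = T g"
    then obtain X Y where XY: "f = fracs X" "g = fracs Y" "fracs (X + Z) = fracs (Y + Z)"
      by (auto simp: T)
    then show "f = g" by (simp add: fracs_eq_iff coord_simps)
  qed
  moreover have "T ` ?F \<subseteq> ?F"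
  proof (intro image_subsetI)
    fix f assume "f \<in> ?F"
    then obtain Y where Y: "Y \<in> int_pts" "f = fracs Y" by blast
    then show "T f \<in> ?F" using int_pts_add[OF Y(1) Z] by (simp add: T)
  qed
  ultimately have "bij_betw T ?F ?F"
    using endo_inj_surj[OF fin] by (simp add: bij_betw_def)
  then have "(\<Sum>f\<in>?F. T f u) = (\<Sum>f\<in>?F. f u)"
    by (rule sum.reindex_bij_betw)
  then have "real (card ?F) * coord u Z = (\<Sum>f\<in>?F. f u + coord u Z - T f u)"
    by (simp add: sum_subtractf sum.distrib)
  also have "\<dots> \<in> \<int>"
    using u by (intro Ints_sum) (simp add: T_def frac_def)
  finally show ?thesis .
qed

text \<open>
  Pigeonhole: as many pairwise inequivalent integer points as the group has elements represent the
  whole group. It replaces any structure theory of groups of order \<open>p\<^sup>2\<close>.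
\<close>

lemma exhausted_by_card:
  assumes K: "finite K" "F ` K \<subseteq> int_pts" "card K = card (fracs ` int_pts)"
    and fin: "finite (fracs ` int_pts)"
    and inj: "\<And>i j. i \<in> K \<Longrightarrow> j \<in> K \<Longrightarrow> (\<And>u. u \<in> V \<Longrightarrow> coord u (F i) - coord u (F j) \<in> \<int>) \<Longrightarrow> i = j"
    and Z: "Z \<in> int_pts"
  obtains i where "i \<in> K" "\<And>u. u \<in> V \<Longrightarrow> coord u Z - coord u (F i) \<in> \<int>"
proof -
  have "inj_on (\<lambda>i. fracs (F i)) K"
    by (rule inj_onI) (auto simp: fracs_eq_iff intro: inj)
  then have "card ((\<lambda>i. fracs (F i)) ` K) = card (fracs ` int_pts)"
    using K by (simp add: card_image)
  moreover have "(\<lambda>i. fracs (F i)) ` K \<subseteq> fracs ` int_pts" using K by auto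
  ultimately have "(\<lambda>i. fracs (F i)) ` K = fracs ` int_pts"
    using fin by (intro card_subset_eq)
  then obtain i where "i \<in> K" "fracs Z = fracs (F i)" using Z by blast
  then show ?thesis using that by (auto simp: fracs_eq_iff)
qed

end

section \<open>Unimodular reduction and lattice pyramids\<close>

text \<open>
  Unimodular linear maps, described through the integer lattice instead of a determinant: this makes
  composition immediate, and \<open>lattice_automorphism_matrix\<close> recovers the determinant condition.
\<close>

definition lattice_automorphism :: "(real^'n \<Rightarrow> real^'n) \<Rightarrow> bool" where
  "lattice_automorphism f \<longleftrightarrow> linear f \<and> (\<forall>x\<in>int_lattice. f x \<in> int_lattice) \<and>
     (\<exists>g. linear g \<and> (\<forall>x\<in>int_lattice. g x \<in> int_lattice) \<and> (\<forall>x. g (f x) = x) \<and> (\<forall>x. f (g x) = x))"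

lemma lattice_automorphismI:
  assumes "linear f" "\<And>x. x \<in> int_lattice \<Longrightarrow> f x \<in> int_lattice"
    and "linear g" "\<And>x. x \<in> int_lattice \<Longrightarrow> g x \<in> int_lattice"
    and "\<And>x. g (f x) = x" "\<And>x. f (g x) = x"
  shows "lattice_automorphism f"
  using assms unfolding lattice_automorphism_def by blast

lemma lattice_automorphism_id: "lattice_automorphism (\<lambda>x. x)"
  by (rule lattice_automorphismI[where g = "\<lambda>x. x"]) (auto simp: linear_id[unfolded id_def])

lemma lattice_automorphism_compose:
  assumes "lattice_automorphism f" "lattice_automorphism g"
  shows "lattice_automorphism (\<lambda>x. f (g x))"
proof -
  obtain f' where f': "linear f'" "\<forall>x\<in>int_lattice. f' x \<in> int_lattice" "\<And>x. f' (f x) = x" "\<And>x. f (f' x) = x"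
    using assms(1) unfolding lattice_automorphism_def by blast
  obtain g' where g': "linear g'" "\<forall>x\<in>int_lattice. g' x \<in> int_lattice" "\<And>x. g' (g x) = x" "\<And>x. g (g' x) = x"
    using assms(2) unfolding lattice_automorphism_def by blast
  show ?thesis
  proof (rule lattice_automorphismI[where g = "\<lambda>x. g' (f' x)"])
    show "linear (\<lambda>x. f (g x))" "linear (\<lambda>x. g' (f' x))"
      using assms linear_compose[of g f] linear_compose[OF f'(1) g'(1)]
      by (auto simp: lattice_automorphism_def o_def)
  qed (use assms f' g' in \<open>auto simp: lattice_automorphism_def\<close>)
qed

lemma lattice_automorphism_scale:
  assumes "c = 1 \<or> c = - 1"
  shows "lattice_automorphism (\<lambda>x. c *\<^sub>R x)"
  using assms
  by (intro lattice_automorphismI[where g = "\<lambda>x. c *\<^sub>R x"])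
     (auto intro!: linearI simp: int_lattice_uminus)

lemma lattice_automorphism_shear:
  assumes a: "a \<in> int_lattice" "a $ k = 0"
  shows "lattice_automorphism (\<lambda>x. x + x $ k *\<^sub>R a)"
proof (rule lattice_automorphismI[where g = "\<lambda>x. x - x $ k *\<^sub>R a"])
  show "linear (\<lambda>x. x + x $ k *\<^sub>R a)" "linear (\<lambda>x. x - x $ k *\<^sub>R a)"
    by (auto intro!: linearI simp: algebra_simps)
  show "x + x $ k *\<^sub>R a \<in> int_lattice" "x - x $ k *\<^sub>R a \<in> int_lattice" if "x \<in> int_lattice" for x
    using that a by (auto intro!: int_lattice_add int_lattice_diff int_lattice_scaleR simp: int_lattice_def)
qed (use a in auto)

lemma det_integral:
  fixes A :: "real^'n^'n"
  assumes "\<And>i j. A $ i $ j \<in> \<int>"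
  shows "det A \<in> \<int>"
  unfolding det_def using assms by (intro Ints_sum Ints_mult Ints_prod) auto

text \<open>
  The matrices of the map and of its inverse are integral, so their determinants are integers with
  product \<open>1\<close>.
\<close>

lemma lattice_automorphism_matrix:
  fixes f :: "real^'n \<Rightarrow> real^'n"
  assumes "lattice_automorphism f"
  obtains U :: "real^'n^'n" where "\<And>i j. U $ i $ j \<in> \<int>" "det U = 1 \<or> det U = - 1" "\<And>v. v v* U = f v"
proof
  obtain g where g: "linear g" "\<forall>x\<in>int_lattice. g x \<in> int_lattice" "\<And>x. g (f x) = x"
    and f: "linear f" "\<forall>x\<in>int_lattice. f x \<in> int_lattice"
    using assms unfolding lattice_automorphism_def by blast
  have entries: "matrix h $ i $ j \<in> \<int>" if "\<forall>x\<in>int_lattice. h x \<in> int_lattice" for h :: "real^'n \<Rightarrow> real^'n" and i j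
    using that int_lattice_axis[of j] by (auto simp: matrix_def int_lattice_def)
  show "transpose (matrix f) $ i $ j \<in> \<int>" for i j
    using entries[OF f(2)] by (simp add: transpose_def)
  show "v v* transpose (matrix f) = f v" for v
    using f(1) by (simp add: matrix_vector_mul)
  have "matrix g ** matrix f = mat 1"
    proof -
    have "g \<circ> f = id" using g(3) by auto
    then show ?thesis
      using matrix_compose[OF f(1) g(1)] matrix_id_mat_1 by metis
  qed
  then have "det (matrix g) * det (matrix f) = 1"
    by (metis det_I det_mul)
  moreover have "det (matrix g) \<in> \<int>" "det (matrix f) \<in> \<int>"
    using entries f(2) g(2) by (auto intro: det_integral)
  ultimately show "det (transpose (matrix f)) = 1 \<or> det (transpose (matrix f)) = - 1"
    by (auto simp: det_transpose elim!: Ints_cases)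
       (metis mult.commute of_int_1 of_int_eq_iff of_int_minus of_int_mult zmult_eq_1_iff)
qed

text \<open>
  The Euclidean algorithm on the coefficients of \<open>a\<close>: as long as two coefficients are nonzero,
  subtracting the smaller from the larger one (up to sign) decreases the sum of the absolute values,
  and the functional changes by a shear. At the end \<open>c\<close> is the greatest common divisor up to sign.
\<close>

lemma lattice_functional_normal_form:
  fixes a :: "real^'n"
  assumes "a \<in> int_lattice" "a \<noteq> 0"
  shows "\<exists>f k c. lattice_automorphism f \<and> (\<forall>x. a \<bullet> x = c * f x $ k)"
  using assms
proof (induction "nat \<lfloor>\<Sum>i\<in>UNIV. \<bar>a $ i\<bar>\<rfloor>" arbitrary: a rule: less_induct)
  case less
  show ?case
  proof (cases "\<exists>j k. j \<noteq> k \<and> a $ j \<noteq> 0 \<and> a $ k \<noteq> 0")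
    case False
    obtain k where k: "a $ k \<noteq> 0" using less.prems(2) by (auto simp: vec_eq_iff)
    have "a \<bullet> x = a $ k * x $ k" for x
    proof -
      have "a \<bullet> x = (\<Sum>i\<in>UNIV. if i = k then a $ k * x $ k else 0)"
        unfolding inner_vec_def using False k by (intro sum.cong) auto
      then show ?thesis by simp
    qed
    then show ?thesis using lattice_automorphism_id by blast
  next
    case True
    then obtain j k where jk: "j \<noteq> k" "a $ j \<noteq> 0" "\<bar>a $ j\<bar> \<le> \<bar>a $ k\<bar>"
      by (metis linear)
    \<comment> \<open>The sign makes subtraction of \<open>s * a $ j\<close> shrink \<open>\<bar>a $ k\<bar>\<close> by \<open>\<bar>a $ j\<bar>\<close>.\<close>
    define s where "s = sgn (a $ k) * sgn (a $ j)"
    have s: "s \<in> \<int>" by (auto simp: s_def sgn_if)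
    define b where "b = a - (s * a $ j) *\<^sub>R axis k 1"
    define g where "g x = x + x $ k *\<^sub>R (s *\<^sub>R axis j 1)" for x :: "real^'n"
    have bk: "b $ k = a $ k - s * a $ j" and bi: "i \<noteq> k \<Longrightarrow> b $ i = a $ i" for i
      by (auto simp: b_def axis_def)
    have b: "b \<in> int_lattice" "b \<noteq> 0"
    proof -
      have "s * a $ j \<in> \<int>" using s less.prems(1) by (auto simp: int_lattice_def)
      then show "b \<in> int_lattice"
        unfolding b_def by (intro int_lattice_diff less.prems int_lattice_scaleR int_lattice_axis)
      show "b \<noteq> 0" using bi[of j] jk by auto
    qed
    have abs_bk: "\<bar>b $ k\<bar> = \<bar>a $ k\<bar> - \<bar>a $ j\<bar>"
      using jk(2,3) by (auto simp: bk s_def sgn_if abs_if split: if_splits)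
    have "(\<Sum>i\<in>UNIV. \<bar>b $ i\<bar>) = (\<Sum>i\<in>UNIV. \<bar>a $ i\<bar>) - \<bar>a $ j\<bar>"
      by (simp add: sum.remove[of UNIV k "\<lambda>i. \<bar>b $ i\<bar>"] sum.remove[of UNIV k "\<lambda>i. \<bar>a $ i\<bar>"] abs_bk bi)
    moreover have "1 \<le> \<bar>a $ j\<bar>"
      using less.prems(1) jk(2) by (auto simp: int_lattice_def intro: Ints_nonzero_abs_ge1)
    moreover have "0 \<le> (\<Sum>i\<in>UNIV. \<bar>b $ i\<bar>)" by (simp add: sum_nonneg)
    ultimately have "nat \<lfloor>\<Sum>i\<in>UNIV. \<bar>b $ i\<bar>\<rfloor> < nat \<lfloor>\<Sum>i\<in>UNIV. \<bar>a $ i\<bar>\<rfloor>"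
      by linarith
    from less.hyps[OF this b] obtain f l c where f: "lattice_automorphism f" "\<And>x. b \<bullet> x = c * f x $ l"
      by blast
    have g: "lattice_automorphism g"
      unfolding g_def using jk(1) s
      by (intro lattice_automorphism_shear int_lattice_scaleR int_lattice_axis) (auto simp: axis_def)
    have "a \<bullet> x = c * f (g x) $ l" for x
    proof -
      have axis_jk: "axis k 1 $ j = (0 :: real)" using jk(1) by (simp add: axis_def)
      have "b \<bullet> g x = b \<bullet> x + x $ k * (s * b $ j)"
        by (simp add: g_def inner_add_right inner_axis)
      also have "\<dots> = a \<bullet> x"
        using jk(1) axis_jk by (simp add: b_def inner_diff_left inner_axis')
      finally show ?thesis using f(2) by metis
    qed
    then show ?thesis using lattice_automorphism_compose[OF f(1) g] by blast
  qed
qed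

text \<open>
  As \<open>a\<close> takes the value \<open>1\<close> on the lattice, the divisor \<open>c\<close> of the normal form is a unit, so \<open>a\<close>
  itself becomes a coordinate functional. Its fibre over \<open>1\<close> contains the image of \<open>z\<close> and the unit
  vector, and a shear that preserves this coordinate moves one to the other.
\<close>

lemma lattice_automorphism_to_axis:
  fixes a z :: "real^'n"
  assumes a: "a \<in> int_lattice" and z: "z \<in> int_lattice" and az: "a \<bullet> z = 1"
  obtains f k where "lattice_automorphism f" "\<And>x. f x $ k = a \<bullet> x" "f z = axis k 1"
proof -
  obtain f k c where f: "lattice_automorphism f" and fk: "\<And>x. a \<bullet> x = c * f x $ k"
    using lattice_functional_normal_form[OF a] az by (metis inner_zero_left zero_neq_one)
  obtain f' where f': "\<forall>x\<in>int_lattice. f' x \<in> int_lattice" "\<And>x. f (f' x) = x"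
    using f unfolding lattice_automorphism_def by blast
  have "f' (axis k 1) \<in> int_lattice" using f'(1) int_lattice_axis by blast
  then have "c \<in> \<int>"
    using inner_int_lattice[OF a, of "f' (axis k 1)"] fk[of "f' (axis k 1)"] f'(2) by simp
  moreover have "f z $ k \<in> \<int>"
    using f z by (auto simp: lattice_automorphism_def int_lattice_def)
  moreover have "c * f z $ k = 1" using fk[of z] az by simp
  ultimately have c: "c = 1 \<or> c = - 1"
    by (auto elim!: Ints_cases)
       (metis of_int_1 of_int_eq_iff of_int_minus of_int_mult zmult_eq_1_iff)
  define h where "h x = c *\<^sub>R f x" for x
  have h: "lattice_automorphism h"
    unfolding h_def using lattice_automorphism_compose[OF lattice_automorphism_scale[OF c] f] .
  have hk: "h x $ k = a \<bullet> x" for x by (simp add: h_def fk)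
  define b where "b = axis k 1 - h z"
  have b: "b \<in> int_lattice" "b $ k = 0"
    using h z hk[of z] az
    by (auto simp: b_def lattice_automorphism_def axis_def intro!: int_lattice_diff int_lattice_axis[unfolded axis_def])
  show ?thesis
  proof
    show "lattice_automorphism (\<lambda>x. h x + h x $ k *\<^sub>R b)"
      by (rule lattice_automorphism_compose[OF lattice_automorphism_shear[OF b] h])
    show "(h x + h x $ k *\<^sub>R b) $ k = a \<bullet> x" for x using b hk by simp
    show "h z + h z $ k *\<^sub>R b = axis k 1" using hk[of z] az by (simp add: b_def)
  qed
qed

context lattice_simplex_vertices
begin

text \<open>
  The facet opposite to \<open>u\<close> lies at lattice distance \<open>1\<close> from \<open>u\<close>. Taking a vertex \<open>w\<close> of that facet as
  origin, the barycentric coordinate of \<open>u\<close> becomes an integral linear functional with value \<open>1\<close> at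
  \<open>u - w\<close>, to which \<open>lattice_automorphism_to_axis\<close> applies.
\<close>

lemma pyramid_if_coord_integral:
  assumes u: "u \<in> V" and int: "\<And>Z. Z \<in> int_pts \<Longrightarrow> coord u Z \<in> \<int>"
  shows "is_lattice_pyramid (convex hull V)"
proof -
  obtain w where w: "w \<in> V" "w \<noteq> u" using other_vertex[OF u] .
  define a where "a = covector u"
  have a_inner: "a \<bullet> x = coord u (x, 0)" for x
    by (simp add: a_def covector_inner)
  have "coord u (axis i 1, 0) \<in> \<int>" for i
    by (rule int) (simp add: int_pts_def int_lattice_axis)
  then have a: "a \<in> int_lattice"
    by (simp add: a_def covector_def int_lattice_def)
  have a_diff: "a \<bullet> (x - w) = (if x = u then 1 else 0)" if "x \<in> V" for x
    using coord_diff[of u x w 1 1] coord_vertex that w by (auto simp: a_inner)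
  have z: "u - w \<in> int_lattice" using u w latV by (auto intro: int_lattice_diff)
  obtain f k where f: "lattice_automorphism f" "\<And>x. f x $ k = a \<bullet> x" "f (u - w) = axis k 1"
    using lattice_automorphism_to_axis[OF a z] a_diff[OF u] by auto
  obtain U :: "real^'n^'n" where U: "\<And>i j. U $ i $ j \<in> \<int>" "det U = 1 \<or> det U = - 1" "\<And>v. v v* U = f v"
    using lattice_automorphism_matrix[OF f(1)] by metis
  have lin: "linear f" using f(1) by (simp add: lattice_automorphism_def)
  have f_lat: "f x \<in> int_lattice" if "x \<in> int_lattice" for x
    using that f(1) by (auto simp: lattice_automorphism_def)
  define \<phi> where "\<phi> x = f (x - w)" for x
  have \<phi>: "\<phi> x = - f w + f x" for x
    by (simp add: \<phi>_def linear_diff[OF lin])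
  have hull: "\<phi> ` (convex hull S) = convex hull (\<phi> ` S)" for S
  proof -
    have "\<phi> ` T = (+) (- f w) ` f ` T" for T by (auto simp: \<phi> image_image)
    then show ?thesis
      by (simp only: convex_hull_translation convex_hull_linear_image[OF lin])
  qed
  define S where "S = convex hull (\<phi> ` (V - {u}))"
  have "unimodularly_equivalent (convex hull V) (pyramid k S)"
    unfolding unimodularly_equivalent_def
  proof (intro exI conjI)
    have "V = insert u (V - {u})" using u by blast
    then have "\<phi> ` V = \<phi> ` (V - {u}) \<union> {\<phi> u}" by blast
    then have \<phi>_V: "\<phi> ` V = \<phi> ` (V - {u}) \<union> {axis k 1}" by (simp add: \<phi>_def f(3))
    have "pyramid k S = \<phi> ` (convex hull V)"
      unfolding pyramid_def S_def hull \<phi>_V by (rule hull_Un_left[symmetric])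
    then show "pyramid k S = (\<lambda>v. v v* U + (- f w)) ` (convex hull V)"
      by (simp add: U(3) \<phi>)
    show "- f w \<in> int_lattice" using w latV f_lat by (auto intro: int_lattice_uminus)
  qed (use U in auto)
  moreover have "S \<subseteq> {x. x $ k = 0}"
  proof -
    have "convex {x :: real^'n. x $ k = 0}"
      using convex_hyperplane[of "axis k 1 :: real^'n" 0] by (simp add: inner_axis')
    moreover have "\<phi> ` (V - {u}) \<subseteq> {x. x $ k = 0}"
      using f(2) a_diff by (auto simp: \<phi>_def)
    ultimately show ?thesis unfolding S_def by (rule hull_minimal[rotated])
  qed
  moreover have "lattice_simplex (CARD('n) - 1) S"
  proof -
    have f_inj: "inj f"
      using f(1) by (metis injI lattice_automorphism_def)
    then have "inj \<phi>" by (auto simp: \<phi> inj_def)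
    have fin: "finite (\<phi> ` (V - {u}))" using finV by simp
    have 1: "vertices S \<subseteq> int_lattice"
    proof -
      have "vertices S \<subseteq> \<phi> ` (V - {u})"
        unfolding vertices_def S_def by (rule extreme_points_of_convex_hull)
      also have "\<dots> \<subseteq> int_lattice"
        using w latV f_lat by (auto simp: \<phi>_def intro!: int_lattice_diff)
      finally show ?thesis .
    qed
    have 2: "\<not> affine_dependent (\<phi> ` (V - {u}))"
    proof -
      have "\<not> affine_dependent (V - {u})" using indep affine_independent_subset by blast
      moreover have img: "\<phi> ` (V - {u}) = (+) (- f w) ` f ` (V - {u})" by (auto simp: \<phi> image_image)
      have "aff_dim (\<phi> ` (V - {u})) = aff_dim (V - {u})"
        unfolding img aff_dim_translation_eq using lin f_inj by simp
      moreover have "card (\<phi> ` (V - {u})) = card (V - {u})"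
        using \<open>inj \<phi>\<close> by (meson card_image inj_on_subset subset_UNIV)
      ultimately show ?thesis
        using fin by (simp add: affine_independent_iff_card)
    qed
    have "card (\<phi> ` (V - {u})) = CARD('n)"
      using u finV cardV \<open>inj \<phi>\<close> by (subst card_image) (auto intro: inj_on_subset simp: card_Diff_singleton)
    moreover have "0 < CARD('n)" by simp
    ultimately have "int (CARD('n) - 1) simplex S"
      unfolding simplex_def S_def using 2 by (intro exI[of _ "\<phi> ` (V - {u})"]) auto
    with 1 show ?thesis
      using fin by (auto simp: lattice_simplex_def lattice_polytope_def polytope_def S_def)
  qed
  ultimately show ?thesis unfolding is_lattice_pyramid_def by blast
qed

end

section \<open>Gorenstein simplices\<close>

context lattice_simplex_vertices
begin

lemma interior_dilate_iff:
  assumes r: "r > 0"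
  shows "x \<in> interior ((\<lambda>x. r *\<^sub>R x + w) ` (convex hull V)) \<longleftrightarrow> (\<forall>u\<in>V. 0 < coord u (x - w, r))"
proof -
  have A: "(\<lambda>x. r *\<^sub>R x + w) ` (convex hull V) = (+) w ` (\<lambda>x. r *\<^sub>R x) ` (convex hull V)"
    by (auto simp: image_image add.commute)
  have B: "interior ((\<lambda>x. r *\<^sub>R x) ` (convex hull V)) = (\<lambda>x. r *\<^sub>R x) ` interior (convex hull V)"
    using r by (intro interior_injective_linear_image) (auto intro!: linearI injI simp: algebra_simps)
  have "interior ((\<lambda>x. r *\<^sub>R x + w) ` (convex hull V)) =
      (\<lambda>x. r *\<^sub>R x + w) ` interior (convex hull V)"
    unfolding A interior_translation B by (auto simp: image_image add.commute)
  also have "x \<in> \<dots> \<longleftrightarrow> (1 / r) *\<^sub>R (x - w) \<in> interior (convex hull V)"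
    using r by (auto simp: image_iff intro!: bexI[of _ "(1 / r) *\<^sub>R (x - w)"])
  also have "\<dots> \<longleftrightarrow> (\<forall>u\<in>V. 0 < coord u (x - w, r))"
  proof -
    have "coord u ((1 / r) *\<^sub>R (x - w), 1) = (1 / r) * coord u (x - w, r)" for u
      using coord_scale[of u "1 / r" "x - w" r] r by simp
    then show ?thesis using r by (simp add: interior_hull_iff zero_less_divide_iff)
  qed
  finally show ?thesis .
qed

text \<open>
  The numbers \<open>e u / r\<close> are the barycentric coordinates of the origin in the simplex with vertices
  \<open>r u + w\<close>. The dual of a simplex with the origin in its interior is again a simplex; its vertex \<open>y u\<close>
  is the normal of the facet opposite to \<open>u\<close>, scaled to take the value \<open>1\<close> on that facet.
\<close>

lemma dual_dilate:
  fixes r :: real and w :: "real^'n"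
  defines "e \<equiv> \<lambda>u. coord u (- w, r)"
  defines "y \<equiv> \<lambda>u. (- 1 / e u) *\<^sub>R covector u"
  defines "D \<equiv> dual_polytope ((\<lambda>x. r *\<^sub>R x + w) ` (convex hull V))"
  assumes r: "r > 0" and e: "\<And>u. u \<in> V \<Longrightarrow> 0 < e u"
  shows "D = convex hull (y ` V)" and "y ` V \<subseteq> vertices D"
proof -
  define q where "q v = r *\<^sub>R v + w" for v
  have D_iff: "x \<in> D \<longleftrightarrow> (\<forall>v\<in>V. q v \<bullet> x \<le> 1)" for x
  proof
    assume "x \<in> D"
    then show "\<forall>v\<in>V. q v \<bullet> x \<le> 1"
      using hull_subset[of V convex] by (auto simp: D_def dual_polytope_def q_def)
  next
    assume "\<forall>v\<in>V. q v \<bullet> x \<le> 1"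
    then have "convex hull (q ` V) \<subseteq> {z. x \<bullet> z \<le> 1}"
      by (intro hull_minimal convex_halfspace_le) (auto simp: inner_commute)
    moreover have "convex hull (q ` V) = (\<lambda>x. r *\<^sub>R x + w) ` (convex hull V)"
      using convex_hull_affinity[of w r V] by (simp add: q_def[abs_def] add.commute)
    ultimately show "x \<in> D" by (auto simp: D_def dual_polytope_def inner_commute)
  qed
  have yq: "q v \<bullet> y u = 1 - (if v = u then r / e u else 0)" if "u \<in> V" "v \<in> V" for u v
  proof -
    have "coord u (q v, 0) = r * coord u (v, 1) - e u"
      using coord_diff[of u "r *\<^sub>R v" "- w" r r] coord_scale[of u r v 1] by (simp add: q_def e_def)
    then show ?thesis
      using e[OF that(1)] coord_vertex[OF that(2)]
      by (auto simp: y_def inner_commute[of "q v"] covector_inner field_simps)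
  qed
  have sum_e: "(\<Sum>v\<in>V. e v) = r" using sum_coord[of "(- w, r)"] by (simp add: e_def)
  have sum_eq: "(\<Sum>v\<in>V. e v *\<^sub>R q v) = 0"
  proof -
    have "(\<Sum>v\<in>V. e v *\<^sub>R q v) = r *\<^sub>R (\<Sum>v\<in>V. e v *\<^sub>R v) + (\<Sum>v\<in>V. e v) *\<^sub>R w"
      by (simp add: q_def scaleR_add_right sum.distrib scaleR_sum_right scaleR_sum_left mult.commute)
    also have "(\<Sum>v\<in>V. e v *\<^sub>R v) = - w" using coord_expand_fst[of "- w" r] by (simp add: e_def)
    finally show ?thesis by (simp add: sum_e)
  qed
  have zero: "x = 0" if "\<And>v. v \<in> V \<Longrightarrow> q v \<bullet> x = 0" for x
  proof -
    have "(\<Sum>v\<in>V. coord v (x, 0) *\<^sub>R q v) = r *\<^sub>R (\<Sum>v\<in>V. coord v (x, 0) *\<^sub>R v) + (\<Sum>v\<in>V. coord v (x, 0)) *\<^sub>R w"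
      by (simp add: q_def scaleR_add_right sum.distrib scaleR_sum_right scaleR_sum_left mult.commute)
    also have "\<dots> = r *\<^sub>R x" using coord_expand_fst[of x 0] sum_coord[of "(x, 0)"] by simp
    finally have "r * (x \<bullet> x) = (\<Sum>v\<in>V. coord v (x, 0) *\<^sub>R q v) \<bullet> x" by simp
    also have "\<dots> = 0" using that by (simp add: inner_sum_left)
    finally show ?thesis using r by simp
  qed
  have y_D: "y u \<in> D" if "u \<in> V" for u
    using that yq[OF that] e[OF that] r by (auto simp: D_iff)
  have conv: "convex D"
  proof -
    have "D = (\<Inter>v\<in>V. {x. q v \<bullet> x \<le> 1})" using D_iff by blast
    then show ?thesis by (simp add: convex_INT convex_halfspace_le)
  qed
  show "D = convex hull (y ` V)"
  proof
    show "convex hull (y ` V) \<subseteq> D" using y_D conv by (intro hull_minimal) auto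
    show "D \<subseteq> convex hull (y ` V)"
    proof
      fix x assume x: "x \<in> D"
      \<comment> \<open>The coefficients are forced by the values \<open>q v \<bullet> x\<close>: on the facet opposite to \<open>y v\<close> one has
         \<open>q v \<bullet> x = 1\<close>, and at \<open>y v\<close> one has \<open>q v \<bullet> x = 1 - r / e v\<close>.\<close>
      define a where "a v = (1 - q v \<bullet> x) * e v / r" for v
      have a0: "0 \<le> a v" if "v \<in> V" for v
        using x that e[OF that] r by (auto simp: a_def D_iff)
      have "(\<Sum>v\<in>V. a v) = ((\<Sum>v\<in>V. e v) - (\<Sum>v\<in>V. e v *\<^sub>R q v) \<bullet> x) / r"
        by (simp add: a_def inner_sum_left sum_subtractf[symmetric] sum_divide_distrib[symmetric] algebra_simps)
      then have a1: "(\<Sum>v\<in>V. a v) = 1" using r by (simp add: sum_e sum_eq)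
      have "(\<Sum>v\<in>V. a v *\<^sub>R y v) - x = 0"
      proof (rule zero)
        fix u assume u: "u \<in> V"
        have "q u \<bullet> (\<Sum>v\<in>V. a v *\<^sub>R y v) = (\<Sum>v\<in>V. a v * (q u \<bullet> y v))"
          by (simp add: inner_sum_right)
        also have "\<dots> = (\<Sum>v\<in>V. a v - (if v = u then a u * r / e u else 0))"
        proof (intro sum.cong refl)
          fix v assume "v \<in> V"
          from yq[OF this u]
          show "a v * (q u \<bullet> y v) = a v - (if v = u then a u * r / e u else 0)"
            by (auto simp: right_diff_distrib)
        qed
        also have "\<dots> = 1 - a u * r / e u"
          using a1 u finV by (simp add: sum_subtractf)
        also have "\<dots> = q u \<bullet> x" using r e[OF u] by (simp add: a_def)
        finally show "q u \<bullet> ((\<Sum>v\<in>V. a v *\<^sub>R y v) - x) = 0" by (simp add: inner_diff_right)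
      qed
      then have "x = (\<Sum>v\<in>V. a v *\<^sub>R y v)" by simp
      also have "\<dots> \<in> convex hull (y ` V)"
        using finV a0 a1 by (intro convex_sum hull_inc convex_convex_hull) auto
      finally show "x \<in> convex hull (y ` V)" .
    qed
  qed
  show "y ` V \<subseteq> vertices D"
  proof
    fix x assume "x \<in> y ` V"
    then obtain u where u: "u \<in> V" and x: "x = y u" by blast
    have "x \<notin> open_segment a b" if a: "a \<in> D" and b: "b \<in> D" for a b
    proof
      assume "x \<in> open_segment a b"
      then obtain t where ab: "a \<noteq> b" and t: "0 < t" "t < 1" and xt: "y u = (1 - t) *\<^sub>R a + t *\<^sub>R b"
        unfolding x in_segment by blast
      \<comment> \<open>All constraints other than the one at \<open>u\<close> are tight at \<open>y u\<close>, hence also at \<open>a\<close> and \<open>b\<close>.\<close>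
      have eq: "q v \<bullet> (a - b) = 0" if v: "v \<in> V" "v \<noteq> u" for v
      proof -
        have "(1 - t) * (q v \<bullet> a) + t * (q v \<bullet> b) = 1"
          using yq[OF u v(1)] v(2) by (simp add: xt inner_add_right)
        moreover have "(1 - t) * (q v \<bullet> a) \<le> (1 - t) * 1" "t * (q v \<bullet> b) \<le> t * 1"
          using a b v t by (auto simp: D_iff intro!: mult_left_mono)
        moreover have "(1 - t) * 1 + t * 1 = (1 :: real)" by simp
        ultimately have "(1 - t) * (q v \<bullet> a) = (1 - t) * 1 \<and> t * (q v \<bullet> b) = t * 1" by argo
        then show ?thesis using t by (simp add: inner_diff_right)
      qed
      have "e u * (q u \<bullet> (a - b)) = 0"
      proof -
        have "0 = (\<Sum>v\<in>V. e v *\<^sub>R q v) \<bullet> (a - b)" by (simp add: sum_eq)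
        also have "\<dots> = (\<Sum>v\<in>V. e v * (q v \<bullet> (a - b)))" by (simp add: inner_sum_left)
        also have "\<dots> = e u * (q u \<bullet> (a - b))"
          using eq by (simp add: sum.remove[OF finV u])
        finally show ?thesis by simp
      qed
      then have "a - b = 0" using eq e[OF u] by (intro zero) (metis mult_eq_0_iff less_irrefl)
      then show False using ab by simp
    qed
    then show "x \<in> vertices D" using y_D[OF u] by (simp add: vertices_def extreme_point_of_def x)
  qed
qed

text \<open>
  The last condition puts all values of \<open>coord u\<close> on integer points into \<open>(1 / m u) \<int>\<close>, and \<open>E\<close>
  attains the generator \<open>1 / m u\<close> of this group. So \<open>E\<close> is an integer point at lattice distance \<open>1\<close>
  from all facets of the cone over the simplex.
\<close>

definition gorenstein_datum :: "(real^'n \<Rightarrow> nat) \<Rightarrow> (real^'n) \<times> real \<Rightarrow> bool" where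
  "gorenstein_datum m E \<longleftrightarrow> E \<in> int_pts \<and>
     (\<forall>u\<in>V. 0 < m u \<and> coord u E = 1 / real (m u) \<and> (\<forall>Z\<in>int_pts. real (m u) * coord u Z \<in> \<int>))"

text \<open>
  If \<open>r\<Delta> + w\<close> is reflexive, then \<open>E = (- w, r)\<close>: integrality of the dual vertices says that \<open>coord u\<close>
  takes values in the multiples of \<open>coord u E\<close>, and since \<open>1\<close> is such a value, \<open>coord u E\<close> is the
  inverse of a positive integer. Conversely, translate \<open>r\<Delta>\<close> so that \<open>E\<close> becomes the origin. An
  interior integer point has all coordinates at least those of \<open>E\<close>; both families sum to \<open>r\<close>, so
  the origin is the only one.
\<close>

lemma gorenstein_iff:
  fixes r :: nat
  assumes r: "0 < r"
  shows "gorenstein r (convex hull V) \<longleftrightarrow> (\<exists>m E. gorenstein_datum m E \<and> snd E = real r)"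
    (is "_ \<longleftrightarrow> ?R")
proof
  assume "gorenstein r (convex hull V)"
  then obtain w where w: "w \<in> int_lattice"
    and refl: "reflexive ((\<lambda>x. real r *\<^sub>R x + w) ` (convex hull V))"
    unfolding gorenstein_def by blast
  define e where "e u = coord u (- w, real r)" for u
  have e: "0 < e u" if "u \<in> V" for u
  proof -
    have "0 \<in> interior ((\<lambda>x. real r *\<^sub>R x + w) ` (convex hull V))"
      using refl unfolding reflexive_def by blast
    then show ?thesis using interior_dilate_iff[of "real r" 0 w] r that by (simp add: e_def)
  qed
  have lat: "(- 1 / e u) *\<^sub>R covector u \<in> int_lattice" if "u \<in> V" for u
    using dual_dilate(2)[of "real r" w] r e refl that
    unfolding reflexive_def lattice_polytope_def e_def by auto
  have mult: "coord u Z / e u \<in> \<int>" if u: "u \<in> V" and Z: "Z \<in> int_pts" for u Z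
  proof -
    \<comment> \<open>A vertex other than \<open>u\<close> has coordinate \<open>0\<close> at \<open>u\<close>, so it can be used to pass to height \<open>0\<close>.\<close>
    obtain v where v: "v \<in> V" "v \<noteq> u" using other_vertex[OF u] .
    obtain z t where zt: "Z = (z, t)" "z \<in> int_lattice" "t \<in> \<int>" using Z by (auto simp: int_pts_def)
    have "coord u Z = coord u (z - t *\<^sub>R v, 0)"
      using coord_diff[of u z "t *\<^sub>R v" t t] coord_scale[of u t v 1] coord_vertex[OF v(1), of u] v(2) zt
      by simp
    moreover have "z - t *\<^sub>R v \<in> int_lattice"
      using zt v latV by (auto intro: int_lattice_diff int_lattice_scaleR)
    ultimately have "- (coord u Z / e u) \<in> \<int>"
      using inner_int_lattice[OF lat[OF u], of "z - t *\<^sub>R v"] by (simp add: covector_inner)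
    then show ?thesis by (metis Ints_minus minus_minus)
  qed
  define m where "m u = nat \<lfloor>1 / e u\<rfloor>" for u
  have m: "real (m u) = 1 / e u" if "u \<in> V" for u
  proof -
    have "1 / e u \<in> \<int>" using mult[OF that int_pts_vertex[OF that]] coord_vertex[OF that] by simp
    moreover have "0 \<le> 1 / e u" using e[OF that] by simp
    ultimately show ?thesis by (auto simp: m_def elim!: Ints_cases)
  qed
  have "gorenstein_datum m (- w, real r)"
    unfolding gorenstein_datum_def
  proof (intro conjI ballI)
    show "0 < m u" if "u \<in> V" for u
      using m[OF that] e[OF that] by (metis of_nat_0_less_iff zero_less_divide_1_iff)
    show "real (m u) * coord u Z \<in> \<int>" if "u \<in> V" "Z \<in> int_pts" for Z u
      using mult[OF that] m[OF that(1)] by simp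
    show "coord u (- w, real r) = 1 / real (m u)" if "u \<in> V" for u
      using m[OF that] by (simp add: e_def)
  qed (use w in \<open>auto simp: int_pts_def int_lattice_uminus\<close>)
  then show ?R by force
next
  assume ?R
  then obtain m E where m: "\<And>u. u \<in> V \<Longrightarrow> 0 < m u"
    and mult: "\<And>Z u. Z \<in> int_pts \<Longrightarrow> u \<in> V \<Longrightarrow> real (m u) * coord u Z \<in> \<int>"
    and E: "E \<in> int_pts" "snd E = real r" "\<And>u. u \<in> V \<Longrightarrow> coord u E = 1 / real (m u)"
    unfolding gorenstein_datum_def by blast
  define w where "w = - fst E"
  have Ew: "E = (- w, real r)" using E(2) by (simp add: w_def prod_eq_iff)
  have w: "w \<in> int_lattice" using E(1) by (auto simp: Ew int_pts_def dest: int_lattice_uminus)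
  have pos: "0 < coord u (- w, real r)" if "u \<in> V" for u using E(3) m that Ew by simp
  let ?Q = "(\<lambda>x. real r *\<^sub>R x + w) ` (convex hull V)"
  have Q: "?Q = convex hull ((\<lambda>x. real r *\<^sub>R x + w) ` V)"
    using convex_hull_affinity[of w "real r" V] by (simp add: add.commute)
  have aff: "aff_dim (convex hull V) = int CARD('n)"
    using aff_dim_affine_independent[OF indep] cardV by (simp add: aff_dim_convex_hull)
  have "vertices (convex hull V) = V"
    using indep by (auto simp: vertices_def extreme_point_of_convex_hull_affine_independent)
  then have 1: "lattice_polytope (convex hull V)"
    using latV finV by (auto simp: lattice_polytope_def polytope_def)
  have 2: "lattice_polytope ?Q"
  proof -
    have "vertices ?Q \<subseteq> (\<lambda>x. real r *\<^sub>R x + w) ` V"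
      unfolding Q vertices_def by (rule extreme_points_of_convex_hull)
    also have "\<dots> \<subseteq> int_lattice"
      using latV w by (auto intro!: int_lattice_add int_lattice_scaleR)
    finally show ?thesis
      using finV unfolding lattice_polytope_def polytope_def Q by blast
  qed
  have 3: "full_dimensional ?Q"
  proof -
    have "(\<lambda>x. real r *\<^sub>R x + w) ` (convex hull V) = (+) w ` (\<lambda>x. real r *\<^sub>R x) ` (convex hull V)"
      by (auto simp: image_image add.commute)
    moreover have "linear (\<lambda>x :: real^'n. real r *\<^sub>R x)" "inj (\<lambda>x :: real^'n. real r *\<^sub>R x)"
      using r by (auto intro!: linearI injI simp: algebra_simps)
    ultimately show ?thesis
      using aff by (simp add: full_dimensional_def aff_dim_translation_eq)
  qed
  have 4: "interior ?Q \<inter> int_lattice = {0}"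
  proof -
    have int: "x \<in> interior ?Q \<longleftrightarrow> (\<forall>u\<in>V. 0 < coord u (x - w, real r))" for x
      using interior_dilate_iff[of "real r" x w] r by simp
    have "x = 0" if x: "x \<in> interior ?Q" "x \<in> int_lattice" for x
    proof -
      have Z: "(x - w, real r) \<in> int_pts" using x w by (auto simp: int_pts_def int_lattice_diff)
      have ge: "1 / real (m u) \<le> coord u (x - w, real r)" if u: "u \<in> V" for u
      proof -
        have "0 < real (m u) * coord u (x - w, real r)" using m[OF u] x int u by simp
        moreover obtain k where "real (m u) * coord u (x - w, real r) = of_int k"
          using mult[OF Z u] by (auto elim: Ints_cases)
        ultimately have "1 \<le> real (m u) * coord u (x - w, real r)" by simp
        then show ?thesis using m[OF u] by (simp add: field_simps)
      qed
      have "(\<Sum>u\<in>V. coord u (x - w, real r) - 1 / real (m u)) = 0"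
        using sum_coord[of "(x - w, real r)"] sum_coord[of E] E by (simp add: sum_subtractf)
      then have "\<forall>u\<in>V. coord u (x - w, real r) - 1 / real (m u) = 0"
        using ge finV by (subst (asm) sum_nonneg_eq_0_iff) auto
      then have "(x - w, real r) = (- w, real r)"
        using E(3) Ew by (intro coord_inject) auto
      then show "x = 0" by simp
    qed
    moreover have "0 \<in> interior ?Q" using int[of 0] pos by simp
    ultimately show ?thesis using int_lattice_zero by blast
  qed
  have 5: "lattice_polytope (dual_polytope ?Q)"
  proof -
    let ?y = "\<lambda>u. (- 1 / coord u (- w, real r)) *\<^sub>R covector u"
    have D: "dual_polytope ?Q = convex hull (?y ` V)"
      using dual_dilate(1)[of "real r" w] r pos by simp
    have "?y u \<in> int_lattice" if u: "u \<in> V" for u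
    proof -
      have "real (m u) * coord u (axis i 1, 0) \<in> \<int>" for i
        using u by (intro mult) (auto simp: int_pts_def int_lattice_axis)
      moreover have "coord u (- w, real r) = 1 / real (m u)" using E(3)[OF u] Ew by simp
      ultimately show ?thesis by (simp add: int_lattice_def covector_def)
    qed
    moreover have "vertices (dual_polytope ?Q) \<subseteq> ?y ` V"
      unfolding D vertices_def by (rule extreme_points_of_convex_hull)
    ultimately show ?thesis using finV unfolding lattice_polytope_def polytope_def D by blast
  qed
  show "gorenstein r (convex hull V)"
    unfolding gorenstein_def reflexive_def
    using r 1 2 3 4 5 aff w by (auto simp: full_dimensional_def)
qed

end

section \<open>Subgroups of the torus\<close>

lemma comm_group_real_add: "comm_group real_add_group"
  by (rule comm_groupI) (auto simp: real_add_group_def intro: exI[of _ "- x" for x])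

lemma normal_Ints: "\<int> \<lhd> real_add_group"
proof (rule comm_group.subgroup_imp_normal[OF comm_group_real_add])
  interpret comm_group real_add_group by (rule comm_group_real_add)
  have inv: "inv\<^bsub>real_add_group\<^esub> x = - x" for x
    by (rule inv_equality) (auto simp: real_add_group_def)
  show "subgroup \<int> real_add_group"
    by (rule subgroup.intro) (auto simp: inv, auto simp: real_add_group_def)
qed

lemma group_torus: "group (torus d)"
  unfolding torus_def RZ_def using normal.factorgroup_is_group[OF normal_Ints] by simp

lemma torus_class_eq_iff: "torus_class d x = torus_class d y \<longleftrightarrow> (\<forall>i\<le>d. x i - y i \<in> \<int>)"
proof -
  have coset: "\<int> #>\<^bsub>real_add_group\<^esub> a = {b. b - a \<in> \<int>}" for a :: real
    by (force simp: r_coset_def real_add_group_def)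
  have "\<int> #>\<^bsub>real_add_group\<^esub> a = \<int> #>\<^bsub>real_add_group\<^esub> b \<longleftrightarrow> a - b \<in> \<int>" for a b :: real
  proof
    assume "\<int> #>\<^bsub>real_add_group\<^esub> a = \<int> #>\<^bsub>real_add_group\<^esub> b"
    moreover have "a \<in> \<int> #>\<^bsub>real_add_group\<^esub> a" by (simp add: coset)
    ultimately show "a - b \<in> \<int>" by (simp add: coset)
  next
    assume ab: "a - b \<in> \<int>"
    have "c - a \<in> \<int> \<longleftrightarrow> c - b \<in> \<int>" for c
      using Ints_add[OF _ ab, of "c - a"] Ints_diff[OF _ ab, of "c - b"] by auto
    then show "\<int> #>\<^bsub>real_add_group\<^esub> a = \<int> #>\<^bsub>real_add_group\<^esub> b" by (simp add: coset)
  qed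
  then show ?thesis
    by (auto simp: torus_class_def restrict_def fun_eq_iff)
qed

lemma torus_class_closed: "torus_class d x \<in> carrier (torus d)"
  by (auto simp: torus_class_def torus_def RZ_def FactGroup_def RCOSETS_def real_add_group_def)

lemma torus_class_mult:
  "torus_class d x \<otimes>\<^bsub>torus d\<^esub> torus_class d y = torus_class d (\<lambda>i. x i + y i)"
proof -
  have "(\<int> #>\<^bsub>real_add_group\<^esub> a) \<otimes>\<^bsub>RZ\<^esub> (\<int> #>\<^bsub>real_add_group\<^esub> b) = \<int> #>\<^bsub>real_add_group\<^esub> (a + b)" for a b
    using normal.rcos_sum[OF normal_Ints, of a b]
    by (simp add: RZ_def FactGroup_def) (simp add: real_add_group_def)
  then show ?thesis
    by (auto simp: torus_class_def torus_def restrict_def fun_eq_iff)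
qed

lemma torus_class_zero: "torus_class d (\<lambda>_. 0) = \<one>\<^bsub>torus d\<^esub>"
  by (auto simp: torus_class_def torus_def RZ_def FactGroup_def r_coset_def real_add_group_def
      restrict_def fun_eq_iff)

lemma torus_class_uminus: "inv\<^bsub>torus d\<^esub> torus_class d x = torus_class d (\<lambda>i. - x i)"
  by (rule group.inv_equality[OF group_torus])
     (simp_all add: torus_class_mult torus_class_closed torus_class_zero)

lemma torus_class_multiple_in_generate:
  assumes "torus_class d g \<in> S"
  shows "torus_class d (\<lambda>i. of_int k * g i) \<in> generate (torus d) S"
proof (induction k rule: int_induct[where k = 0])
  case base
  then show ?case by (simp add: torus_class_zero generate.one)
next
  case (step1 k)
  from generate.eng[OF this(2) generate.incl[OF assms]]
  show ?case by (simp add: torus_class_mult algebra_simps)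
next
  case (step2 k)
  from generate.eng[OF this(2) generate.inv[OF assms]]
  show ?case by (simp add: torus_class_mult torus_class_uminus algebra_simps)
qed

lemma generate_torus_pair:
  "generate (torus d) {torus_class d g, torus_class d h} =
     {torus_class d (\<lambda>i. of_int k * g i + of_int l * h i) | k l. True}"
proof (intro equalityI subsetI)
  fix x assume "x \<in> generate (torus d) {torus_class d g, torus_class d h}"
  then show "x \<in> {torus_class d (\<lambda>i. of_int k * g i + of_int l * h i) | k l. True}"
  proof induction
    case one
    show ?case unfolding torus_class_zero[symmetric]
      by (force intro: exI[of _ 0])
  next
    case (incl x)
    then consider "x = torus_class d g" | "x = torus_class d h" by blast
    then show ?case
    proof cases
      case 1
      then have "x = torus_class d (\<lambda>i. of_int 1 * g i + of_int 0 * h i)" by simp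
      then show ?thesis by blast
    next
      case 2
      then have "x = torus_class d (\<lambda>i. of_int 0 * g i + of_int 1 * h i)" by simp
      then show ?thesis by blast
    qed
  next
    case (inv x)
    then consider "x = torus_class d g" | "x = torus_class d h" by blast
    then show ?case
    proof cases
      case 1
      then have "inv\<^bsub>torus d\<^esub> x = torus_class d (\<lambda>i. of_int (- 1) * g i + of_int 0 * h i)"
        by (simp add: torus_class_uminus)
      then show ?thesis by blast
    next
      case 2
      then have "inv\<^bsub>torus d\<^esub> x = torus_class d (\<lambda>i. of_int 0 * g i + of_int (- 1) * h i)"
        by (simp add: torus_class_uminus)
      then show ?thesis by blast
    qed
  next
    case (eng x y)
    then obtain k l k' l' where "x = torus_class d (\<lambda>i. of_int k * g i + of_int l * h i)"
      "y = torus_class d (\<lambda>i. of_int k' * g i + of_int l' * h i)" by blast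
    then have "x \<otimes>\<^bsub>torus d\<^esub> y = torus_class d (\<lambda>i. of_int (k + k') * g i + of_int (l + l') * h i)"
      by (simp add: torus_class_mult algebra_simps)
    then show ?case by blast
  qed
next
  fix x assume "x \<in> {torus_class d (\<lambda>i. of_int k * g i + of_int l * h i) | k l. True}"
  then obtain k l where "x = torus_class d (\<lambda>i. of_int k * g i) \<otimes>\<^bsub>torus d\<^esub> torus_class d (\<lambda>i. of_int l * h i)"
    by (auto simp: torus_class_mult)
  then show "x \<in> generate (torus d) {torus_class d g, torus_class d h}"
    by (auto intro!: generate.eng torus_class_multiple_in_generate)
qed

context lattice_simplex_vertices
begin

text \<open>
  Changing coordinates by integers changes a point by an integral combination of lifted vertices,
  hence preserves integrality. This turns statements modulo \<open>1\<close> into exact ones.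
\<close>

lemma realize_coords:
  assumes "E \<in> int_pts" "\<And>u. u \<in> V \<Longrightarrow> coord u E - x u \<in> \<int>"
  obtains F where "F \<in> int_pts" "\<And>u. u \<in> V \<Longrightarrow> coord u F = x u"
proof
  let ?F = "\<Sum>u\<in>V. x u *\<^sub>R (u, 1 :: real)"
  have "?F = E - (\<Sum>u\<in>V. (coord u E - x u) *\<^sub>R (u, 1))"
    by (subst coord_expand[of E]) (simp add: scaleR_diff_left sum_subtractf del: scaleR_Pair)
  also have "\<dots> \<in> int_pts"
    using assms by (intro int_pts_diff int_pts_sum int_pts_scale_vertex)
  finally show "?F \<in> int_pts" .
  show "coord u ?F = x u" if "u \<in> V" for u using coord_combination[OF that] .
qed

lemma Lambda_eq:
  assumes v: "bij_betw v {0..CARD('n)} V"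
  shows "Lambda v = (\<lambda>Z. torus_class CARD('n) (\<lambda>i. coord (v i) Z)) ` int_pts"
proof (intro equalityI subsetI)
  fix y assume "y \<in> Lambda v"
  then obtain x where y: "y = torus_class CARD('n) x"
    and x: "(\<Sum>i = 0..CARD('n). x i *\<^sub>R (v i, 1 :: real)) \<in> int_pts"
    by (auto simp: Lambda_def int_pts_def)
  define w where "w = inv_into {0..CARD('n)} v"
  have w: "w (v i) = i" if "i \<le> CARD('n)" for i
    using v that by (simp add: w_def bij_betw_def inv_into_f_f)
  have "(\<Sum>i = 0..CARD('n). x i *\<^sub>R (v i, 1 :: real)) = (\<Sum>i = 0..CARD('n). x (w (v i)) *\<^sub>R (v i, 1))"
    by (intro sum.cong) (auto simp: w)
  also have "\<dots> = (\<Sum>u\<in>V. x (w u) *\<^sub>R (u, 1))"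
    by (rule sum.reindex_bij_betw[OF v])
  finally have eq: "(\<Sum>i = 0..CARD('n). x i *\<^sub>R (v i, 1 :: real)) = (\<Sum>u\<in>V. x (w u) *\<^sub>R (u, 1))" .
  have "coord (v i) (\<Sum>i = 0..CARD('n). x i *\<^sub>R (v i, 1 :: real)) = x i" if "i \<le> CARD('n)" for i
    using that v unfolding eq by (subst coord_combination) (auto simp: w bij_betw_def)
  then have "y = torus_class CARD('n) (\<lambda>i. coord (v i) (\<Sum>i = 0..CARD('n). x i *\<^sub>R (v i, 1 :: real)))"
    unfolding y torus_class_eq_iff by simp
  then show "y \<in> (\<lambda>Z. torus_class CARD('n) (\<lambda>i. coord (v i) Z)) ` int_pts" using x by blast
next
  fix y assume "y \<in> (\<lambda>Z. torus_class CARD('n) (\<lambda>i. coord (v i) Z)) ` int_pts"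
  then obtain Z where Z: "Z \<in> int_pts" "y = torus_class CARD('n) (\<lambda>i. coord (v i) Z)" by blast
  have "(\<Sum>i = 0..CARD('n). coord (v i) Z *\<^sub>R (v i, 1 :: real)) = Z"
    using sum.reindex_bij_betw[OF v, of "\<lambda>u. coord u Z *\<^sub>R (u, 1 :: real)"] coord_expand[of Z] by metis
  then show "y \<in> Lambda v" using Z by (auto simp: Lambda_def int_pts_def)
qed

lemma Lambda_eq_generate_pair:
  assumes v: "bij_betw v {0..CARD('n)} V"
  shows "Lambda v = generate (torus CARD('n)) {torus_class CARD('n) g, torus_class CARD('n) h} \<longleftrightarrow>
    (\<exists>E\<in>int_pts. \<forall>i\<le>CARD('n). coord (v i) E - g i \<in> \<int>) \<and>
    (\<exists>F\<in>int_pts. \<forall>i\<le>CARD('n). coord (v i) F - h i \<in> \<int>) \<and>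
    (\<forall>Z\<in>int_pts. \<exists>k l. \<forall>i\<le>CARD('n). coord (v i) Z - (of_int k * g i + of_int l * h i) \<in> \<int>)"
    (is "?L = ?G \<longleftrightarrow> ?E \<and> ?F \<and> ?A")
proof
  assume eq: "?L = ?G"
  have "torus_class CARD('n) g \<in> ?G" "torus_class CARD('n) h \<in> ?G"
    by (auto intro: generate.incl)
  then have "torus_class CARD('n) g \<in> ?L" "torus_class CARD('n) h \<in> ?L" by (simp_all add: eq)
  then have "\<exists>E\<in>int_pts. torus_class CARD('n) (\<lambda>i. coord (v i) E) = torus_class CARD('n) g"
    "\<exists>E\<in>int_pts. torus_class CARD('n) (\<lambda>i. coord (v i) E) = torus_class CARD('n) h"
    by (force simp: Lambda_eq[OF v])+
  then have "?E \<and> ?F" by (simp add: torus_class_eq_iff)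
  moreover have ?A
  proof
    fix Z assume "Z \<in> int_pts"
    then have "torus_class CARD('n) (\<lambda>i. coord (v i) Z) \<in> ?G"
      using eq by (auto simp: Lambda_eq[OF v])
    then show "\<exists>k l. \<forall>i\<le>CARD('n). coord (v i) Z - (of_int k * g i + of_int l * h i) \<in> \<int>"
      by (auto simp: generate_torus_pair torus_class_eq_iff)
  qed
  ultimately show "?E \<and> ?F \<and> ?A" by blast
next
  assume R: "?E \<and> ?F \<and> ?A"
  show "?L = ?G"
  proof
    show "?L \<subseteq> ?G"
      using R by (auto simp: Lambda_eq[OF v] generate_torus_pair torus_class_eq_iff)
    show "?G \<subseteq> ?L"
    proof
      fix x assume "x \<in> ?G"
      then obtain k l where x: "x = torus_class CARD('n) (\<lambda>i. of_int k * g i + of_int l * h i)"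
        by (auto simp: generate_torus_pair)
      obtain E F where E: "E \<in> int_pts" "\<And>i. i \<le> CARD('n) \<Longrightarrow> coord (v i) E - g i \<in> \<int>"
        and F: "F \<in> int_pts" "\<And>i. i \<le> CARD('n) \<Longrightarrow> coord (v i) F - h i \<in> \<int>"
        using R by blast
      let ?Z = "of_int k *\<^sub>R E + of_int l *\<^sub>R F"
      have "?Z \<in> int_pts" using E(1) F(1) by (intro int_pts_add int_pts_scale) auto
      moreover have "x = torus_class CARD('n) (\<lambda>i. coord (v i) ?Z)"
        unfolding x torus_class_eq_iff
      proof (intro allI impI)
        fix i assume i: "i \<le> CARD('n)"
        have "of_int k * g i + of_int l * h i - coord (v i) ?Z =
            - (of_int k * (coord (v i) E - g i) + of_int l * (coord (v i) F - h i))"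
          by (simp add: coord_simps algebra_simps)
        also have "\<dots> \<in> \<int>"
          using E(2)[OF i] F(2)[OF i] by (intro Ints_minus Ints_add Ints_mult) auto
        finally show "of_int k * g i + of_int l * h i - coord (v i) ?Z \<in> \<int>" .
      qed
      ultimately show "x \<in> ?L" by (auto simp: Lambda_eq[OF v])
    qed
  qed
qed

lemma Lambda_eq_generate_single:
  assumes v: "bij_betw v {0..CARD('n)} V"
  shows "Lambda v = generate (torus CARD('n)) {torus_class CARD('n) g} \<longleftrightarrow>
    (\<exists>E\<in>int_pts. \<forall>i\<le>CARD('n). coord (v i) E - g i \<in> \<int>) \<and>
    (\<forall>Z\<in>int_pts. \<exists>k. \<forall>i\<le>CARD('n). coord (v i) Z - of_int k * g i \<in> \<int>)"
proof -
  have "(\<exists>k l. \<forall>i\<le>CARD('n). coord (v i) Z - (of_int k * g i + of_int l * g i) \<in> \<int>) \<longleftrightarrow>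
      (\<exists>k. \<forall>i\<le>CARD('n). coord (v i) Z - of_int k * g i \<in> \<int>)" for Z
  proof
    assume "\<exists>k l. \<forall>i\<le>CARD('n). coord (v i) Z - (of_int k * g i + of_int l * g i) \<in> \<int>"
    then show "\<exists>k. \<forall>i\<le>CARD('n). coord (v i) Z - of_int k * g i \<in> \<int>"
      by (metis distrib_right of_int_add)
  next
    assume "\<exists>k. \<forall>i\<le>CARD('n). coord (v i) Z - of_int k * g i \<in> \<int>"
    then obtain k where "\<forall>i\<le>CARD('n). coord (v i) Z - (of_int k * g i + of_int 0 * g i) \<in> \<int>" by auto
    then show "\<exists>k l. \<forall>i\<le>CARD('n). coord (v i) Z - (of_int k * g i + of_int l * g i) \<in> \<int>" by blast
  qed
  then show ?thesis
    using Lambda_eq_generate_pair[OF v, of g g] by simp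
qed

end

section \<open>Arithmetic modulo a prime and the weights of the generators\<close>

lemma bij_betw_nth_atMost:
  assumes "distinct xs" "length xs = Suc n"
  shows "bij_betw ((!) xs) {0..n} (set xs)"
  using assms by (intro bij_betw_nth) auto

lemma inverse_mod_prime:
  fixes x :: int
  assumes "prime p" "\<not> int p dvd x"
  obtains c where "int p dvd c * x - 1"
proof -
  have "coprime (int p) x"
    using assms by (intro prime_imp_coprime) auto
  then obtain c e where "c * x + e * int p = 1"
    using bezout_int[of x "int p"] by (auto simp: coprime_iff_gcd_eq_1 gcd.commute)
  then have "c * x - 1 = int p * (- e)" by (simp add: algebra_simps)
  then show ?thesis using that by (metis dvd_triv_left)
qed

lemma of_int_divide_Ints_iff:
  assumes "0 < n" shows "real_of_int k / real n \<in> \<int> \<longleftrightarrow> int n dvd k"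
proof
  assume "real_of_int k / real n \<in> \<int>"
  then obtain l where "real_of_int k / real n = of_int l" by (auto elim: Ints_cases)
  then have "real_of_int k = real_of_int (l * int n)" using assms by (simp add: field_simps)
  then have "k = l * int n" by linarith
  then show "int n dvd k" by simp
next
  assume "int n dvd k"
  then obtain l where "k = int n * l" by blast
  then show "real_of_int k / real n \<in> \<int>" using assms by simp
qed

definition cyclic_weight :: "nat \<Rightarrow> nat \<Rightarrow> nat \<Rightarrow> real" where
  "cyclic_weight p s i = (if i < s then 1 / real p else 1 / real (p\<^sup>2))"

lemma sum_cyclic_weight:
  assumes "0 < p" "s \<le> n"
  shows "(\<Sum>i = 0..n. cyclic_weight p s i) * real (p\<^sup>2) = real (s * p + (n + 1 - s))"
proof -
  have "(\<Sum>i = 0..n. cyclic_weight p s i) = (\<Sum>i = 0..<s. cyclic_weight p s i) + (\<Sum>i = s..n. cyclic_weight p s i)"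
    using assms by (subst sum.union_disjoint[symmetric]) (auto intro!: sum.cong)
  also have "\<dots> = real s / real p + real (n + 1 - s) / real (p\<^sup>2)"
    by (simp add: cyclic_weight_def)
  finally show ?thesis using assms(1) by (simp add: field_simps power2_eq_square)
qed

text \<open>
  The two weight functions are the generators of the noncyclic case; they add up to the constant
  \<open>1 / p\<close> modulo \<open>1\<close>.
\<close>

definition first_weight :: "nat \<Rightarrow> nat \<Rightarrow> (nat \<Rightarrow> nat) \<Rightarrow> nat \<Rightarrow> real" where
  "first_weight p s a i =
     (if i = 0 then (2 - real (\<Sum>j = 1..s-1. a j)) / real p
      else if i < s then (real (a i) + 1) / real p
      else if i = s then 0
      else 1 / real p)"

definition second_weight :: "nat \<Rightarrow> nat \<Rightarrow> (nat \<Rightarrow> nat) \<Rightarrow> nat \<Rightarrow> real" where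
  "second_weight p s a i =
     (if i = 0 then (real (\<Sum>j = 1..s-1. a j) - 1) / real p
      else if i < s then (real p - real (a i)) / real p
      else if i = s then 1 / real p
      else 0)"

lemma sum_weights:
  assumes "0 < p" "1 \<le> s" shows "first_weight p s a i + second_weight p s a i - 1 / real p \<in> \<int>"
proof -
  have "first_weight p s a i + second_weight p s a i = 1 / real p + (if 0 < i \<and> i < s then 1 else 0)"
    using assms by (auto simp: first_weight_def second_weight_def field_simps)
  then show ?thesis by simp
qed

lemma weight_multiples:
  assumes "0 < p"
  shows "real p * first_weight p s a i \<in> \<int>" "real p * second_weight p s a i \<in> \<int>"
  using assms by (auto simp: first_weight_def second_weight_def)

section \<open>The two group structures of order a squared prime\<close>

context lattice_simplex_vertices
begin

text \<open>
  At a vertex with \<open>m w = p\<^sup>2\<close> the multiples of \<open>E\<close> by \<open>0, \<dots>, p\<^sup>2 - 1\<close> are distinguished by their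
  coordinate at \<open>w\<close>, so they exhaust the group. The ordering lists the vertices with \<open>m u = p\<close> first.
\<close>

lemma cyclic_case:
  assumes p: "prime p" and r: "0 < r" and card: "card (fracs ` int_pts) = p\<^sup>2"
    and datum: "gorenstein_datum m E" and snd: "snd E = real r"
    and m: "\<And>u. u \<in> V \<Longrightarrow> m u = p \<or> m u = p\<^sup>2"
    and w: "w \<in> V" "m w = p\<^sup>2"
  obtains s v where "s \<le> CARD('n) - 1" "r * p\<^sup>2 - 1 = (CARD('n) - s) + p * s"
    "bij_betw v {0..CARD('n)} V"
    "Lambda v = generate (torus CARD('n)) {torus_class CARD('n) (cyclic_weight p s)}"
proof -
  have p1: "1 < p" using p by (rule prime_gt_1_nat)
  have E: "E \<in> int_pts" "\<And>u. u \<in> V \<Longrightarrow> coord u E = 1 / real (m u)"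
    using datum by (auto simp: gorenstein_datum_def)
  have fin: "finite (fracs ` int_pts)" using card p1 by (intro card_ge_0_finite) simp
  have exhaust: "\<exists>k. \<forall>u\<in>V. coord u Z - of_int k * coord u E \<in> \<int>" if Z: "Z \<in> int_pts" for Z
  proof -
    let ?F = "\<lambda>k. of_int k *\<^sub>R E"
    have sub: "?F ` {0..<int (p\<^sup>2)} \<subseteq> int_pts"
      using E(1) by (intro image_subsetI int_pts_scale) auto
    have inj: "k = l" if "k \<in> {0..<int (p\<^sup>2)}" "l \<in> {0..<int (p\<^sup>2)}"
      "\<And>u. u \<in> V \<Longrightarrow> coord u (?F k) - coord u (?F l) \<in> \<int>" for k l
    proof -
      have "real_of_int (k - l) / real (p\<^sup>2) \<in> \<int>"
        using that(3)[OF w(1)] E(2)[OF w(1)] by (simp add: coord_simps w(2) diff_divide_distrib)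
      then have "int (p\<^sup>2) dvd k - l" using p1 by (subst (asm) of_int_divide_Ints_iff) auto
      then have "k mod int (p\<^sup>2) = l mod int (p\<^sup>2)" by (simp add: mod_eq_dvd_iff)
      then show "k = l" using that(1,2) by simp
    qed
    have cardK: "card {0..<int (p\<^sup>2)} = card (fracs ` int_pts)" by (simp add: card nat_power_eq)
    obtain k where "\<And>u. u \<in> V \<Longrightarrow> coord u Z - coord u (?F k) \<in> \<int>"
      by (rule exhausted_by_card[OF _ sub cardK fin inj Z]) auto
    then show ?thesis by (auto simp: coord_simps)
  qed
  define A where "A = {u \<in> V. m u = p}"
  define B where "B = {u \<in> V. m u \<noteq> p}"
  define s where "s = card A"
  obtain xs where xs: "set xs = A" "distinct xs"
    using finite_distinct_list[of A] finV by (auto simp: A_def)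
  obtain ys where ys: "set ys = B" "distinct ys"
    using finite_distinct_list[of B] finV by (auto simp: B_def)
  define v where "v = (!) (xs @ ys)"
  have len: "length xs = s" "length ys = card B" using xs ys by (auto simp: s_def distinct_card)
  have sB: "s + card B = CARD('n) + 1"
  proof -
    have "card (A \<union> B) = s + card B"
      unfolding s_def using finV by (intro card_Un_disjoint) (auto simp: A_def B_def)
    moreover have "A \<union> B = V" by (auto simp: A_def B_def)
    ultimately show ?thesis using cardV by simp
  qed
  have "w \<in> B" using w p1 by (simp add: B_def power2_eq_square)
  then have "0 < card B" using finV by (auto simp: B_def card_gt_0_iff)
  then have sn: "s \<le> CARD('n)" using sB by linarith
  have v: "bij_betw v {0..CARD('n)} V"
  proof -
    have "set (xs @ ys) = V" using xs ys by (auto simp: A_def B_def)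
    moreover have "distinct (xs @ ys)" using xs ys by (auto simp: A_def B_def)
    moreover have "length (xs @ ys) = Suc CARD('n)" using len sB by simp
    ultimately show ?thesis unfolding v_def using bij_betw_nth_atMost by metis
  qed
  have coord_v: "coord (v i) E = cyclic_weight p s i" if "i \<le> CARD('n)" for i
  proof (cases "i < s")
    case True
    then have "v i \<in> A" using xs len by (auto simp: v_def nth_append)
    then show ?thesis using True E(2) by (simp add: A_def cyclic_weight_def)
  next
    case False
    then have "v i \<in> B" using ys len that sB nth_mem[of "i - s" ys] by (auto simp: v_def nth_append)
    then show ?thesis using False E(2) m by (auto simp: B_def cyclic_weight_def)
  qed
  have vV: "v i \<in> V" if "i \<le> CARD('n)" for i using v that by (auto simp: bij_betw_def)
  have eq: "r * p\<^sup>2 = s * p + (CARD('n) + 1 - s)"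
  proof -
    have "real r = (\<Sum>u\<in>V. coord u E)" using sum_coord[of E] snd by simp
    also have "\<dots> = (\<Sum>i = 0..CARD('n). coord (v i) E)"
      by (rule sum.reindex_bij_betw[OF v, symmetric])
    also have "\<dots> = (\<Sum>i = 0..CARD('n). cyclic_weight p s i)"
      by (intro sum.cong) (auto simp: coord_v)
    finally have "real (r * p\<^sup>2) = real (s * p + (CARD('n) + 1 - s))"
      using sum_cyclic_weight[of p s "CARD('n)"] p1 sn by simp
    then show ?thesis by linarith
  qed
  \<comment> \<open>With a single vertex of weight \<open>1 / p\<^sup>2\<close> the coordinates could not sum to an integer.\<close>
  have "s \<noteq> CARD('n)"
  proof
    assume "s = CARD('n)"
    then have "r * p\<^sup>2 = s * p + 1" using eq by simp
    moreover have "p dvd r * p\<^sup>2" by (simp add: power2_eq_square)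
    ultimately have "p dvd 1" by (metis dvd_add_right_iff dvd_triv_right)
    then show False using p1 by simp
  qed
  then have "s \<le> CARD('n) - 1" "r * p\<^sup>2 - 1 = (CARD('n) - s) + p * s"
    using sn eq by (auto simp: mult.commute)
  moreover have "Lambda v = generate (torus CARD('n)) {torus_class CARD('n) (cyclic_weight p s)}"
    unfolding Lambda_eq_generate_single[OF v]
  proof (intro conjI ballI bexI[of _ E])
    show "\<forall>i\<le>CARD('n). coord (v i) E - cyclic_weight p s i \<in> \<int>" by (simp add: coord_v)
    show "\<exists>k. \<forall>i\<le>CARD('n). coord (v i) Z - of_int k * cyclic_weight p s i \<in> \<int>" if "Z \<in> int_pts" for Z
      using exhaust[OF that] vV coord_v by metis
  qed (rule E)
  ultimately show ?thesis using that v by blast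
qed

text \<open>
  The generator consists of the numbers \<open>1 / p\<close> and \<open>1 / p\<^sup>2\<close>, so it is itself the point required by
  \<open>gorenstein_datum\<close>; the numerical condition says that its coordinates sum to \<open>r\<close>.
\<close>

lemma cyclic_converse:
  assumes p: "prime p" and r: "0 < r" and s: "s \<le> CARD('n) - 1"
    and eq: "r * p\<^sup>2 - 1 = (CARD('n) - s) + p * s"
    and v: "bij_betw v {0..CARD('n)} V"
    and gen: "Lambda v = generate (torus CARD('n)) {torus_class CARD('n) (cyclic_weight p s)}"
  shows "\<exists>m E. gorenstein_datum m E \<and> snd E = real r"
proof -
  have p1: "1 < p" using p by (rule prime_gt_1_nat)
  define w where "w = inv_into {0..CARD('n)} v"
  have w: "w (v i) = i" if "i \<le> CARD('n)" for i
    using v that by (simp add: w_def bij_betw_def inv_into_f_f)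
  have w': "w u \<le> CARD('n)" "v (w u) = u" if "u \<in> V" for u
    using v that inv_into_into[of u v "{0..CARD('n)}"] f_inv_into_f[of u v "{0..CARD('n)}"]
    by (auto simp: w_def bij_betw_def)
  obtain E0 where "E0 \<in> int_pts" and E0: "\<forall>i\<le>CARD('n). coord (v i) E0 - cyclic_weight p s i \<in> \<int>"
    and gen': "\<And>Z. Z \<in> int_pts \<Longrightarrow> \<exists>k. \<forall>i\<le>CARD('n). coord (v i) Z - of_int k * cyclic_weight p s i \<in> \<int>"
    using gen unfolding Lambda_eq_generate_single[OF v] by blast
  moreover have "coord u E0 - cyclic_weight p s (w u) \<in> \<int>" if "u \<in> V" for u
    using E0 w'[OF that] by metis
  ultimately obtain E where E: "E \<in> int_pts" "\<And>u. u \<in> V \<Longrightarrow> coord u E = cyclic_weight p s (w u)"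
    using realize_coords[of E0 "\<lambda>u. cyclic_weight p s (w u)"] by blast
  define m where "m u = (if w u < s then p else p\<^sup>2)" for u
  have mw: "real (m u) * cyclic_weight p s (w u) = 1" for u
    using p1 by (simp add: m_def cyclic_weight_def)
  have "gorenstein_datum m E"
    unfolding gorenstein_datum_def
  proof (intro conjI ballI)
    fix u assume u: "u \<in> V"
    show "0 < m u" using p1 by (simp add: m_def)
    show "coord u E = 1 / real (m u)" by (simp add: E(2)[OF u] m_def cyclic_weight_def)
    show "real (m u) * coord u Z \<in> \<int>" if Z: "Z \<in> int_pts" for Z
    proof -
      obtain k where "\<forall>i\<le>CARD('n). coord (v i) Z - of_int k * cyclic_weight p s i \<in> \<int>" using gen'[OF Z] by blast
      then have "coord u Z - of_int k * cyclic_weight p s (w u) \<in> \<int>" using w'[OF u] by metis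
      then have "real (m u) * (coord u Z - of_int k * cyclic_weight p s (w u)) + of_int k \<in> \<int>" by simp
      moreover have "real (m u) * (coord u Z - of_int k * cyclic_weight p s (w u)) + of_int k = real (m u) * coord u Z"
        using mw[of u] by (simp add: algebra_simps)
      ultimately show ?thesis by simp
    qed
  qed (rule E)
  moreover have "snd E = real r"
  proof -
    have "snd E = (\<Sum>u\<in>V. cyclic_weight p s (w u))" using sum_coord[of E] E(2) by simp
    also have "\<dots> = (\<Sum>i = 0..CARD('n). cyclic_weight p s (w (v i)))"
      by (rule sum.reindex_bij_betw[OF v, symmetric])
    also have "\<dots> = (\<Sum>i = 0..CARD('n). cyclic_weight p s i)"
      by (intro sum.cong) (auto simp: w)
    finally have "snd E * real (p\<^sup>2) = real (s * p + (CARD('n) + 1 - s))"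
      using sum_cyclic_weight[of p s "CARD('n)"] p1 s by simp
    moreover have "0 < r * p\<^sup>2" using r p1 by simp
    then have "r * p\<^sup>2 = (CARD('n) - s) + p * s + 1" using eq by linarith
    then have "s * p + (CARD('n) + 1 - s) = r * p\<^sup>2" using s by (simp add: mult.commute)
    ultimately have "snd E * real (p\<^sup>2) = real r * real (p\<^sup>2)" by (simp only: of_nat_mult)
    then show ?thesis using p1 by simp
  qed
  ultimately show ?thesis by blast
qed

text \<open>
  The sum of the two generators is the constant vector \<open>1 / p\<close>, and all coordinates in the group are
  multiples of \<open>1 / p\<close>. The sum of the coordinates is \<open>(d + 1) / p = r\<close>.
\<close>

lemma elementary_converse:
  assumes p: "prime p" and r: "0 < r" and d: "CARD('n) = r * p - 1" and s: "1 \<le> s"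
    and v: "bij_betw v {0..CARD('n)} V"
    and gen: "Lambda v = generate (torus CARD('n))
      {torus_class CARD('n) (first_weight p s a), torus_class CARD('n) (second_weight p s a)}"
  shows "\<exists>m E. gorenstein_datum m E \<and> snd E = real r"
proof -
  have p1: "1 < p" using p by (rule prime_gt_1_nat)
  have onto: "\<exists>i\<le>CARD('n). u = v i" if "u \<in> V" for u
    using v that by (auto simp: bij_betw_def)
  obtain G H where GH: "G \<in> int_pts" "H \<in> int_pts"
    and G: "\<And>i. i \<le> CARD('n) \<Longrightarrow> coord (v i) G - first_weight p s a i \<in> \<int>"
    and H: "\<And>i. i \<le> CARD('n) \<Longrightarrow> coord (v i) H - second_weight p s a i \<in> \<int>"
    and gen': "\<And>Z. Z \<in> int_pts \<Longrightarrow> \<exists>k l. \<forall>i\<le>CARD('n).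
      coord (v i) Z - (of_int k * first_weight p s a i + of_int l * second_weight p s a i) \<in> \<int>"
    using gen unfolding Lambda_eq_generate_pair[OF v] by blast
  have "coord u (G + H) - 1 / real p \<in> \<int>" if "u \<in> V" for u
  proof -
    obtain i where i: "i \<le> CARD('n)" "u = v i" using onto[OF \<open>u \<in> V\<close>] by blast
    have "(coord u G - first_weight p s a i) + (coord u H - second_weight p s a i)
        + (first_weight p s a i + second_weight p s a i - 1 / real p) \<in> \<int>"
      using G[OF i(1)] H[OF i(1)] sum_weights[of p s a i] s p1 i(2) by (intro Ints_add) auto
    then show ?thesis by (simp add: coord_simps algebra_simps)
  qed
  then obtain E where E: "E \<in> int_pts" "\<And>u. u \<in> V \<Longrightarrow> coord u E = 1 / real p"
    using realize_coords[OF int_pts_add[OF GH], of "\<lambda>_. 1 / real p"] by blast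
  have "gorenstein_datum (\<lambda>_. p) E"
    unfolding gorenstein_datum_def
  proof (intro conjI ballI)
    fix u assume u: "u \<in> V"
    show "0 < p" using p1 by simp
    show "coord u E = 1 / real p" using E(2)[OF u] .
    show "real p * coord u Z \<in> \<int>" if Z: "Z \<in> int_pts" for Z
    proof -
      obtain i where i: "i \<le> CARD('n)" "u = v i" using onto[OF u] by blast
      obtain k l where "coord u Z - (of_int k * first_weight p s a i + of_int l * second_weight p s a i) \<in> \<int>"
        using gen'[OF Z] i by blast
      then have "real p * (coord u Z - (of_int k * first_weight p s a i + of_int l * second_weight p s a i)) \<in> \<int>"
        by simp
      moreover have "of_int k * (real p * first_weight p s a i) \<in> \<int>" "of_int l * (real p * second_weight p s a i) \<in> \<int>"
        using weight_multiples[of p s a i] p1 by simp_all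
      ultimately have "real p * (coord u Z - (of_int k * first_weight p s a i + of_int l * second_weight p s a i))
          + (of_int k * (real p * first_weight p s a i) + of_int l * (real p * second_weight p s a i)) \<in> \<int>"
        by (intro Ints_add)
      then show ?thesis by (simp add: algebra_simps)
    qed
  qed (rule E)
  moreover have "snd E = real r"
  proof -
    have "snd E = (\<Sum>u\<in>V. 1 / real p)" using sum_coord[of E] E(2) by simp
    also have "\<dots> = real (CARD('n) + 1) / real p" by (simp add: cardV)
    also have "CARD('n) + 1 = r * p" using d r p1 by simp
    finally show ?thesis using p1 by simp
  qed
  ultimately show ?thesis by blast
qed

text \<open>
  The multiples of \<open>E\<close> make up at most \<open>p < p\<^sup>2\<close> elements, so there is an \<open>H\<close> outside of them. Its
  coordinates times \<open>p\<close> are integers that are not all congruent modulo \<open>p\<close>; subtracting a multiple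
  of \<open>E\<close> moves one of them to \<open>0\<close>, and multiplication by an inverse modulo \<open>p\<close> moves another to \<open>1\<close>.
\<close>

lemma elementary_second_generator:
  assumes p: "prime p" and card: "card (fracs ` int_pts) = p\<^sup>2"
    and E: "E \<in> int_pts" "\<And>u. u \<in> V \<Longrightarrow> coord u E = 1 / real p"
    and mult: "\<And>Z u. Z \<in> int_pts \<Longrightarrow> u \<in> V \<Longrightarrow> real p * coord u Z \<in> \<int>"
  obtains F b u1 u2 where "F \<in> int_pts" "\<And>u. u \<in> V \<Longrightarrow> coord u F = real (b u) / real p"
    "\<And>u. b u < p" "u1 \<in> V" "b u1 = 0" "u2 \<in> V" "b u2 = 1"
proof -
  have p1: "1 < p" using p by (rule prime_gt_1_nat)
  have fin: "finite (fracs ` int_pts)" using card p1 by (intro card_ge_0_finite) simp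
  have "\<exists>H\<in>int_pts. \<forall>k::int. \<exists>u\<in>V. coord u H - of_int k / real p \<notin> \<int>"
  proof (rule ccontr)
    assume "\<not> ?thesis"
    then have all: "\<exists>k::int. \<forall>u\<in>V. coord u Z - of_int k / real p \<in> \<int>" if "Z \<in> int_pts" for Z
      using that by blast
    have "fracs ` int_pts \<subseteq> (\<lambda>k. fracs (of_int k *\<^sub>R E)) ` {0..<int p}"
    proof (intro image_subsetI)
      fix Z assume "Z \<in> int_pts"
      then obtain k :: int where k: "\<And>u. u \<in> V \<Longrightarrow> coord u Z - of_int k / real p \<in> \<int>" using all by blast
      have "fracs Z = fracs (of_int (k mod int p) *\<^sub>R E)"
        unfolding fracs_eq_iff
      proof
        fix u assume u: "u \<in> V"
        have "real_of_int k = real p * of_int (k div int p) + of_int (k mod int p)"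
          by (metis mult_div_mod_eq of_int_add of_int_mult of_int_of_nat_eq)
        then have "real_of_int k / real p = of_int (k div int p) + of_int (k mod int p) / real p"
          using p1 by (simp add: add_divide_distrib)
        then have eq: "coord u Z - coord u (of_int (k mod int p) *\<^sub>R E) =
            (coord u Z - of_int k / real p) + of_int (k div int p)"
          by (simp add: coord_simps E(2)[OF u])
        show "coord u Z - coord u (of_int (k mod int p) *\<^sub>R E) \<in> \<int>"
          unfolding eq using k[OF u] by simp
      qed
      then show "fracs Z \<in> (\<lambda>k. fracs (of_int k *\<^sub>R E)) ` {0..<int p}"
        using p1 by (intro image_eqI[of _ _ "k mod int p"]) auto
    qed
    then have "card (fracs ` int_pts) \<le> card {0..<int p}"
      by (rule surj_card_le[rotated]) simp
    then show False using p1 by (simp add: card power2_eq_square)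
  qed
  then obtain H where H: "H \<in> int_pts" "\<And>k::int. \<exists>u\<in>V. coord u H - of_int k / real p \<notin> \<int>" by blast
  have "\<exists>n::int. coord u H = of_int n / real p" if u: "u \<in> V" for u
  proof -
    obtain n where "real p * coord u H = of_int n" using mult[OF H(1) u] by (auto elim: Ints_cases)
    then have "coord u H = of_int n / real p" using p1 by (simp add: field_simps)
    then show ?thesis ..
  qed
  then obtain n :: "real^'n \<Rightarrow> int" where n: "\<And>u. u \<in> V \<Longrightarrow> coord u H = of_int (n u) / real p" by metis
  obtain u1 where u1: "u1 \<in> V" using cardV by (metis card.empty ex_in_conv add_is_0 one_neq_zero)
  obtain u2 where u2: "u2 \<in> V" "coord u2 H - of_int (n u1) / real p \<notin> \<int>" using H(2) by blast
  then have "real_of_int (n u2 - n u1) / real p \<notin> \<int>" using n[OF u2(1)] by (simp add: diff_divide_distrib)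
  then have "\<not> int p dvd n u2 - n u1" using of_int_divide_Ints_iff[of p "n u2 - n u1"] p1 by simp
  then obtain c where c: "int p dvd c * (n u2 - n u1) - 1" using inverse_mod_prime[OF p] by blast
  \<comment> \<open>The coordinates of the new point are only known modulo \<open>1\<close>; \<open>b\<close> takes residues below \<open>p\<close>.\<close>
  define b where "b u = nat ((c * (n u - n u1)) mod int p)" for u
  have b: "int (b u) = (c * (n u - n u1)) mod int p" for u using p1 by (simp add: b_def)
  let ?Z = "of_int c *\<^sub>R (H - of_int (n u1) *\<^sub>R E)"
  have Z: "?Z \<in> int_pts" using H(1) E(1) by (intro int_pts_scale int_pts_diff) auto
  have "coord u ?Z - real (b u) / real p \<in> \<int>" if u: "u \<in> V" for u
  proof -
    have "coord u ?Z - real (b u) / real p = of_int (c * (n u - n u1) - int (b u)) / real p"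
      by (simp add: coord_simps n[OF u] E(2)[OF u] diff_divide_distrib right_diff_distrib)
    moreover have "int p dvd c * (n u - n u1) - int (b u)"
      unfolding b by (rule dvd_minus_mod)
    ultimately show ?thesis using p1 by (simp only: of_int_divide_Ints_iff)
  qed
  then obtain F where F: "F \<in> int_pts" "\<And>u. u \<in> V \<Longrightarrow> coord u F = real (b u) / real p"
    using realize_coords[OF Z, of "\<lambda>u. real (b u) / real p"] by blast
  moreover have "b u < p" for u
  proof -
    have "int (b u) < int p" unfolding b using p1 by simp
    then show ?thesis by simp
  qed
  moreover have "b u1 = 0" by (simp add: b_def)
  moreover have "b u2 = 1"
  proof -
    have "(c * (n u2 - n u1)) mod int p = 1 mod int p" using c by (simp add: mod_eq_dvd_iff)
    then have "int (b u2) = 1" unfolding b using p1 by simp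
    then show ?thesis by simp
  qed
  ultimately show ?thesis using that u1 u2(1) by blast
qed

text \<open>
  The zero coordinate \<open>b u1\<close> and the unit coordinate \<open>b u2\<close> distinguish the \<open>p\<^sup>2\<close> combinations of \<open>E\<close>
  and \<open>F\<close>, which therefore exhaust the group. As the \<open>b u\<close> sum to a multiple of \<open>p\<close>, some further
  \<open>b u0\<close> is nonzero. The ordering lists \<open>u0\<close>, the remaining vertices with nonzero \<open>b\<close>, then \<open>u2\<close>, and
  last the vertices with \<open>b u = 0\<close>; there \<open>F\<close> is the second generator and \<open>E - F\<close> the first one.
\<close>

lemma elementary_case:
  assumes p: "prime p" and r: "0 < r" and card: "card (fracs ` int_pts) = p\<^sup>2"
    and datum: "gorenstein_datum m E" and snd: "snd E = real r"
    and m: "\<And>u. u \<in> V \<Longrightarrow> m u = p"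
  obtains s a v where "CARD('n) = r * p - 1" "1 \<le> s" "s \<le> CARD('n) - 1"
    "\<forall>i\<in>{1..s-1}. 1 \<le> a i \<and> a i \<le> p - 1" "bij_betw v {0..CARD('n)} V"
    "Lambda v = generate (torus CARD('n))
      {torus_class CARD('n) (first_weight p s a), torus_class CARD('n) (second_weight p s a)}"
proof -
  have p1: "1 < p" using p by (rule prime_gt_1_nat)
  have fin: "finite (fracs ` int_pts)" using card p1 by (intro card_ge_0_finite) simp
  have E: "E \<in> int_pts" "\<And>u. u \<in> V \<Longrightarrow> coord u E = 1 / real p"
    using datum m by (auto simp: gorenstein_datum_def)
  have mult: "real p * coord u Z \<in> \<int>" if "Z \<in> int_pts" "u \<in> V" for Z u
    using datum m that by (auto simp: gorenstein_datum_def)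
  have d: "CARD('n) = r * p - 1"
  proof -
    have "real r = real (CARD('n) + 1) / real p"
      using sum_coord[of E] E(2) snd by (simp add: cardV)
    then have "real (r * p) = real (CARD('n) + 1)" using p1 by (simp add: field_simps)
    then have "r * p = CARD('n) + 1" by linarith
    then show ?thesis by simp
  qed
  obtain F b u1 u2 where F: "F \<in> int_pts" "\<And>u. u \<in> V \<Longrightarrow> coord u F = real (b u) / real p"
    and b: "\<And>u. b u < p" and u1: "u1 \<in> V" "b u1 = 0" and u2: "u2 \<in> V" "b u2 = 1"
    using elementary_second_generator[OF p card E mult] by blast
  have exhaust: "\<exists>k l. \<forall>u\<in>V. coord u Z - (of_int k * coord u E + of_int l * coord u F) \<in> \<int>"
    if Z: "Z \<in> int_pts" for Z
  proof -
    let ?F = "\<lambda>(k, l). of_int k *\<^sub>R E + of_int l *\<^sub>R F"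
    let ?K = "{0..<int p} \<times> {0..<int p}"
    have sub: "?F ` ?K \<subseteq> int_pts"
    proof (rule image_subsetI)
      fix kl assume "kl \<in> ?K"
      then show "?F kl \<in> int_pts"
        using E(1) F(1) by (cases kl) (auto intro!: int_pts_add int_pts_scale simp del: scaleR_Pair)
    qed
    have inj: "i = j" if i: "i \<in> ?K" and j: "j \<in> ?K" and eq: "\<And>u. u \<in> V \<Longrightarrow> coord u (?F i) - coord u (?F j) \<in> \<int>" for i j
    proof -
      obtain k l k' l' where ij: "i = (k, l)" "j = (k', l')" by (cases i, cases j)
      have "real_of_int (k - k') / real p \<in> \<int>"
        using eq[OF u1(1)] E(2)[OF u1(1)] F(2)[OF u1(1)] u1(2)
        by (simp add: ij coord_simps diff_divide_distrib)
      then have "k mod int p = k' mod int p"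
        using p1 by (subst (asm) of_int_divide_Ints_iff) (auto simp: mod_eq_dvd_iff)
      then have k: "k = k'" using i j by (simp add: ij)
      have "real_of_int (l - l') / real p \<in> \<int>"
        using eq[OF u2(1)] E(2)[OF u2(1)] F(2)[OF u2(1)] u2(2)
        by (simp add: ij k coord_simps diff_divide_distrib)
      then have "l mod int p = l' mod int p"
        using p1 by (subst (asm) of_int_divide_Ints_iff) (auto simp: mod_eq_dvd_iff)
      then show ?thesis using i j k by (simp add: ij)
    qed
    have cardK: "card ?K = card (fracs ` int_pts)" by (simp add: card card_cartesian_product power2_eq_square)
    obtain i where "\<And>u. u \<in> V \<Longrightarrow> coord u Z - coord u (?F i) \<in> \<int>"
      by (rule exhausted_by_card[OF _ sub cardK fin inj Z]) auto
    then show ?thesis by (cases i) (auto simp: coord_simps)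
  qed
  obtain N where N: "(\<Sum>u\<in>V. b u) = p * N"
  proof -
    have "real_of_int (int (\<Sum>u\<in>V. b u)) / real p = snd F"
      using sum_coord[of F] F(2) by (simp add: sum_divide_distrib)
    also have "\<dots> \<in> \<int>" using F(1) by (auto simp: int_pts_def)
    finally have "int p dvd int (\<Sum>u\<in>V. b u)" using p1 by (subst (asm) of_int_divide_Ints_iff) auto
    then have "p dvd (\<Sum>u\<in>V. b u)" by (simp only: int_dvd_int_iff)
    then show ?thesis using that by blast
  qed
  obtain u0 where u0: "u0 \<in> V" "u0 \<noteq> u2" "b u0 \<noteq> 0"
  proof (rule ccontr)
    assume "\<not> thesis"
    then have "\<forall>u\<in>V - {u2}. b u = 0" using that by blast
    then have "p * N = 1" using N u2 by (simp add: sum.remove[OF finV u2(1)])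
    then show False using p1 by simp
  qed
  define A where "A = {u \<in> V. b u \<noteq> 0 \<and> u \<noteq> u0 \<and> u \<noteq> u2}"
  define B where "B = {u \<in> V. b u = 0}"
  obtain xs where xs: "set xs = A" "distinct xs"
    using finite_distinct_list[of A] finV by (auto simp: A_def)
  obtain ys where ys: "set ys = B" "distinct ys"
    using finite_distinct_list[of B] finV by (auto simp: B_def)
  define L where "L = u0 # xs @ u2 # ys"
  define v where "v = (!) L"
  define s where "s = length xs + 1"
  have setL: "set L = V" using xs ys u0 u2 by (auto simp: L_def A_def B_def)
  have distL: "distinct L" using xs ys u0 u2 by (auto simp: L_def A_def B_def)
  have lenL: "length L = Suc CARD('n)" using distinct_card[OF distL] setL cardV by simp
  have v: "bij_betw v {0..CARD('n)} V"
    using bij_betw_nth_atMost[OF distL lenL] by (simp add: v_def setL)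
  have lens: "CARD('n) = s + length ys" using lenL by (simp add: L_def s_def)
  have "ys \<noteq> []" using u1 ys by (auto simp: B_def)
  then have s: "1 \<le> s" "s \<le> CARD('n) - 1" using lens by (cases ys; simp add: s_def)+
  have v0: "v 0 = u0" by (simp add: v_def L_def)
  have vA: "v i \<in> A" if "1 \<le> i" "i < s" for i
    using that xs by (cases i) (auto simp: v_def L_def s_def nth_append)
  have vs: "v s = u2" by (simp add: v_def L_def s_def nth_append)
  have vB: "v i \<in> B" if "s < i" "i \<le> CARD('n)" for i
  proof -
    obtain j where j: "i = s + Suc j" using \<open>s < i\<close> less_iff_Suc_add by auto
    then have "v i = ys ! j" by (simp add: v_def L_def s_def nth_append)
    moreover have "j < length ys" using that lens j by linarith
    ultimately show ?thesis using ys nth_mem by metis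
  qed
  define a where "a i = p - b (v i)" for i
  have a: "real (a i) = real p - real (b (v i))" for i using b[of "v i"] by (simp add: a_def)
  have sum_split: "(\<Sum>u\<in>V. real (b u)) = real (b u0) + (\<Sum>i = 1..s-1. real (b (v i))) + 1"
  proof -
    have "(\<Sum>u\<in>V. real (b u)) = sum_list (map (\<lambda>u. real (b u)) L)"
      using sum_list_distinct_conv_sum_set[OF distL] setL by metis
    also have "\<dots> = real (b u0) + sum_list (map (\<lambda>u. real (b u)) xs) + 1"
    proof -
      have "sum_list (map (\<lambda>u. real (b u)) ys) = (\<Sum>u\<in>B. real (b u))"
        using sum_list_distinct_conv_sum_set[OF ys(2)] ys(1) by metis
      then show ?thesis using u2(2) by (simp add: L_def B_def)
    qed
    also have "sum_list (map (\<lambda>u. real (b u)) xs) = (\<Sum>i = 0..<length xs. real (b (xs ! i)))"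
      by (simp add: sum_list_sum_nth)
    also have "\<dots> = (\<Sum>i = 0..<length xs. real (b (v (Suc i))))"
      by (intro sum.cong) (auto simp: v_def L_def nth_append)
    also have "\<dots> = (\<Sum>i = 1..s-1. real (b (v i)))"
      using sum.shift_bounds_Suc_ivl[of "\<lambda>i. real (b (v i))" 0 "length xs", symmetric]
      by (simp add: s_def atLeastLessThanSuc_atLeastAtMost)
    finally show ?thesis .
  qed
  have second: "coord (v i) F - second_weight p s a i \<in> \<int>" if i: "i \<le> CARD('n)" for i
  proof -
    have vV: "v i \<in> V" using v i by (auto simp: bij_betw_def)
    consider "i = 0" | "1 \<le> i" "i < s" | "i = s" | "s < i" by linarith
    then show ?thesis
    proof cases
      \<comment> \<open>The first weight is determined by the integrality of the coordinate sum.\<close>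
      case 1
      let ?X = "real (\<Sum>j = 1..s-1. a j)"
      have "?X = real p * real (s - 1) - (\<Sum>j = 1..s-1. real (b (v j)))"
        by (simp add: a sum_subtractf)
      moreover have "(\<Sum>u\<in>V. real (b u)) = real p * real N"
        using arg_cong[OF N, of real] by simp
      ultimately have X: "real (b u0) - (?X - 1) = real p * of_int (int N - int (s - 1))"
        using sum_split by (simp add: algebra_simps)
      have "coord (v i) F - second_weight p s a i = (real (b u0) - (?X - 1)) / real p"
        using F(2)[OF vV] 1 by (simp add: v0 second_weight_def diff_divide_distrib)
      also have "\<dots> = of_int (int N - int (s - 1))"
        unfolding X using p1 by simp
      finally have "coord (v i) F - second_weight p s a i = of_int (int N - int (s - 1))" .
      then show ?thesis by simp
    next
      case 2
      then show ?thesis using F(2)[OF vV] by (simp add: second_weight_def a)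
    next
      case 3
      then show ?thesis using F(2)[OF vV] s u2(2) by (simp add: second_weight_def vs)
    next
      case 4
      then show ?thesis using F(2)[OF vV] vB[OF 4 i] by (simp add: second_weight_def B_def)
    qed
  qed
  have first: "coord (v i) (E - F) - first_weight p s a i \<in> \<int>" if i: "i \<le> CARD('n)" for i
  proof -
    have vV: "v i \<in> V" using v i by (auto simp: bij_betw_def)
    have "coord (v i) (E - F) - first_weight p s a i =
        - (coord (v i) F - second_weight p s a i) - (first_weight p s a i + second_weight p s a i - 1 / real p)"
      by (simp add: coord_simps E(2)[OF vV])
    also have "\<dots> \<in> \<int>"
      using p1 s(1) by (intro Ints_diff[OF Ints_minus[OF second[OF i]] sum_weights]) auto
    finally show ?thesis .
  qed
  have "Lambda v = generate (torus CARD('n))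
      {torus_class CARD('n) (first_weight p s a), torus_class CARD('n) (second_weight p s a)}"
    unfolding Lambda_eq_generate_pair[OF v]
  proof (intro conjI ballI)
    show "\<exists>G\<in>int_pts. \<forall>i\<le>CARD('n). coord (v i) G - first_weight p s a i \<in> \<int>"
      using first E(1) F(1) int_pts_diff by blast
    show "\<exists>G\<in>int_pts. \<forall>i\<le>CARD('n). coord (v i) G - second_weight p s a i \<in> \<int>"
      using second F(1) by blast
    fix Z assume "Z \<in> int_pts"
    then obtain k l where kl: "\<And>u. u \<in> V \<Longrightarrow> coord u Z - (of_int k * coord u E + of_int l * coord u F) \<in> \<int>"
      using exhaust by blast
    \<comment> \<open>Since \<open>E\<close> is the sum of the generators, \<open>k E + l F = k (E - F) + (k + l) F\<close>.\<close>
    have "coord (v i) Z - (of_int k * first_weight p s a i + of_int (k + l) * second_weight p s a i) \<in> \<int>"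
      if i: "i \<le> CARD('n)" for i
    proof -
      have vV: "v i \<in> V" using v i by (auto simp: bij_betw_def)
      have "coord (v i) Z - (of_int k * first_weight p s a i + of_int (k + l) * second_weight p s a i) =
          (coord (v i) Z - (of_int k * coord (v i) E + of_int l * coord (v i) F))
          + of_int k * (coord (v i) (E - F) - first_weight p s a i)
          + of_int (k + l) * (coord (v i) F - second_weight p s a i)"
        by (simp add: coord_simps algebra_simps)
      also have "\<dots> \<in> \<int>"
        using kl[OF vV] first[OF i] second[OF i] by (intro Ints_add Ints_mult[OF Ints_of_int])
      finally show ?thesis .
    qed
    then show "\<exists>k l. \<forall>i\<le>CARD('n).
        coord (v i) Z - (of_int k * first_weight p s a i + of_int l * second_weight p s a i) \<in> \<int>"
      by blast
  qed
  moreover have "\<forall>i\<in>{1..s-1}. 1 \<le> a i \<and> a i \<le> p - 1"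
  proof
    fix i assume "i \<in> {1..s-1}"
    then have "v i \<in> A" using s by (intro vA) auto
    then have "0 < b (v i)" by (simp add: A_def)
    then show "1 \<le> a i \<and> a i \<le> p - 1" using b[of "v i"] unfolding a_def by linarith
  qed
  ultimately show ?thesis using that d s v by blast
qed

end

theorem theorem0p2:
  fixes \<Delta> :: "(real^'n) set" and p r d :: nat
  assumes "prime p" and "0 < r" and "d = CARD('n)"
    and "lattice_simplex d \<Delta>"
    and "normalized_volume \<Delta> = real (p\<^sup>2)"
    and "\<not> is_lattice_pyramid \<Delta>"
  shows "gorenstein r \<Delta> \<longleftrightarrow>
    (\<exists>s. 0 \<le> s \<and> s \<le> d - 1 \<and> r * p\<^sup>2 - 1 = (d - s) + p * s \<and>
       (\<exists>v. vertex_ordering v \<Delta> \<and>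
          Lambda v = generate (torus d)
            {torus_class d (\<lambda>i. if i < s then 1 / real p else 1 / real (p\<^sup>2))}))
    \<or>
    (d = r * p - 1 \<and>
     (\<exists>s a. 1 \<le> s \<and> s \<le> d - 1 \<and> (\<forall>i\<in>{1..s-1}. 1 \<le> a i \<and> a i \<le> p - 1) \<and>
       (\<exists>v. vertex_ordering v \<Delta> \<and>
          Lambda v = generate (torus d)
            {torus_class d (\<lambda>i.
               if i = 0 then (2 - real (\<Sum>j = 1..s-1. a j)) / real p
               else if i < s then (real (a i) + 1) / real p
               else if i = s then 0
               else 1 / real p),
             torus_class d (\<lambda>i.
               if i = 0 then (real (\<Sum>j = 1..s-1. a j) - 1) / real p
               else if i < s then (real p - real (a i)) / real p
               else if i = s then 1 / real p
               else 0)})))"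
proof -
  define V where "V = vertices \<Delta>"
  obtain C where C: "\<not> affine_dependent C" "int (card C) = int d + 1" "\<Delta> = convex hull C"
    using assms(4) by (auto simp: lattice_simplex_def simplex_def)
  have "V = C"
    using C by (auto simp: V_def vertices_def extreme_point_of_convex_hull_affine_independent)
  then have hull: "\<Delta> = convex hull V" by (simp add: C)
  interpret lattice_simplex_vertices V
    using C assms(3,4) \<open>V = C\<close>
    by unfold_locales (auto simp: lattice_simplex_def lattice_polytope_def V_def)
  have ordering: "vertex_ordering v \<Delta> \<longleftrightarrow> bij_betw v {0..CARD('n)} V" for v
    by (simp add: vertex_ordering_def V_def)
  have p1: "1 < p" using assms(1) by (rule prime_gt_1_nat)
  have card: "card (fracs ` int_pts) = p\<^sup>2"
    using normalized_volume_eq_card assms(5) unfolding hull by linarith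
  have forward: "(\<exists>s v. s \<le> CARD('n) - 1 \<and> r * p\<^sup>2 - 1 = (CARD('n) - s) + p * s \<and>
      bij_betw v {0..CARD('n)} V \<and>
      Lambda v = generate (torus CARD('n)) {torus_class CARD('n) (cyclic_weight p s)}) \<or>
    CARD('n) = r * p - 1 \<and> (\<exists>s a v. 1 \<le> s \<and> s \<le> CARD('n) - 1 \<and>
      (\<forall>i\<in>{1..s-1}. 1 \<le> a i \<and> a i \<le> p - 1) \<and> bij_betw v {0..CARD('n)} V \<and>
      Lambda v = generate (torus CARD('n))
        {torus_class CARD('n) (first_weight p s a), torus_class CARD('n) (second_weight p s a)})"
    if datum: "gorenstein_datum m E" and snd: "snd E = real r" for m E
  proof -
    have m: "m u = p \<or> m u = p\<^sup>2" if u: "u \<in> V" for u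
    proof -
      have fin: "finite (fracs ` int_pts)" using card p1 by (intro card_ge_0_finite) simp
      have E: "E \<in> int_pts" "coord u E = 1 / real (m u)" "0 < m u"
        and int: "\<And>Z. Z \<in> int_pts \<Longrightarrow> real (m u) * coord u Z \<in> \<int>"
        using datum u by (auto simp: gorenstein_datum_def)
      have "real_of_int (int (p\<^sup>2)) / real (m u) \<in> \<int>"
        using card_fracs_annihilates[OF fin E(1) u] by (simp add: card E(2))
      then have "m u dvd p\<^sup>2"
        using E(3) by (subst (asm) of_int_divide_Ints_iff) (auto simp del: of_nat_power)
      then obtain i where "i \<le> 2" "m u = p ^ i"
        using divides_primepow_nat[OF assms(1)] by blast
      moreover have "i \<noteq> 0"
      proof
        assume "i = 0"
        then have "is_lattice_pyramid \<Delta>"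
          using int \<open>m u = p ^ i\<close> u unfolding hull by (intro pyramid_if_coord_integral) auto
        then show False using assms(6) by simp
      qed
      ultimately have "i = 1 \<or> i = 2" by linarith
      then show ?thesis using \<open>m u = p ^ i\<close> by auto
    qed
    show ?thesis
    proof (cases "\<exists>w\<in>V. m w = p\<^sup>2")
      case True
      then obtain w where "w \<in> V" "m w = p\<^sup>2" by blast
      from cyclic_case[OF assms(1,2) card datum snd m this] show ?thesis by metis
    next
      case False
      then have "m u = p" if "u \<in> V" for u using m that by blast
      from elementary_case[OF assms(1,2) card datum snd this] show ?thesis by metis
    qed
  qed
  have "gorenstein r \<Delta> \<longleftrightarrow> (\<exists>m E. gorenstein_datum m E \<and> snd E = real r)"
    unfolding hull by (rule gorenstein_iff[OF assms(2)])
  also have "\<dots> \<longleftrightarrow>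
    (\<exists>s v. s \<le> CARD('n) - 1 \<and> r * p\<^sup>2 - 1 = (CARD('n) - s) + p * s \<and>
      bij_betw v {0..CARD('n)} V \<and>
      Lambda v = generate (torus CARD('n)) {torus_class CARD('n) (cyclic_weight p s)}) \<or>
    CARD('n) = r * p - 1 \<and> (\<exists>s a v. 1 \<le> s \<and> s \<le> CARD('n) - 1 \<and>
      (\<forall>i\<in>{1..s-1}. 1 \<le> a i \<and> a i \<le> p - 1) \<and> bij_betw v {0..CARD('n)} V \<and>
      Lambda v = generate (torus CARD('n))
        {torus_class CARD('n) (first_weight p s a), torus_class CARD('n) (second_weight p s a)})"
    (is "_ \<longleftrightarrow> ?cyclic \<or> ?elementary")
  proof
    assume "\<exists>m E. gorenstein_datum m E \<and> snd E = real r"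
    then show "?cyclic \<or> ?elementary" using forward by blast
  next
    assume "?cyclic \<or> ?elementary"
    then show "\<exists>m E. gorenstein_datum m E \<and> snd E = real r"
    proof
      assume ?cyclic
      then show ?thesis using cyclic_converse[OF assms(1,2)] by blast
    next
      assume ?elementary
      then show ?thesis using elementary_converse[OF assms(1,2)] by blast
    qed
  qed
  finally show ?thesis
    unfolding ordering cyclic_weight_def first_weight_def second_weight_def assms(3) by auto
qed

end
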